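(* Suppose the nodes are uniformly distributed in the unit square $S$ (that is, $f\equiv 1$, $\epsilon_1=\epsilon_2=1$) and the edge weight function $h:\mathbb{R}^2\times\mathbb{R}^2\to[0,\infty)$ satisfies $c_1 d(x,y)\leq h(x,y)=h(y,x)\leq c_2 d(x,y)$ for all $x,y\in S$ for some positive constants $c_1,c_2$, together with the following two properties. (b1) For every $a>0$, $h(au,av)=a\cdot h(u,v)$ for all $u,v\in\mathbb{R}^2$. (b2) There exists a constant $h_0>0$ such that $h(b+u,b+v)\leq h_0\cdot h(u,v)$ for all $b,u,v\in\mathbb{R}^2$. Then $$0<\liminf_{n}\frac{\mathbb{E}MST_n}{n^{1-\frac{\alpha}{2}}}\leq\limsup_{n}\frac{\mathbb{E}MST_n}{n^{1-\frac{\alpha}{2}}}\leq h_0^{\alpha}\cdot\liminf_{n}\frac{\mathbb{E}MST_n}{n^{1-\frac{\alpha}{2}}}<\infty.$$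
   Context: $S$ is the unit square in $\mathbb{R}^2$, $d(x,y)$ is the Euclidean distance, $\alpha>0$ is a constant, $h$ is deterministic and measurable, and $X_1,X_2,\ldots$ are i.i.d. uniform in $S$. $K_n$ is the complete graph on the nodes $X_1,\ldots,X_n$, the edge $(X_i,X_j)$ having weight $(h(X_i,X_j))^{\alpha}$. $MST_n$ is the minimum, over all spanning trees of $K_n$, of the sum of the weights of the edges of the tree. *)

theory Defs
  imports "HOL-Probability.Probability"
begin

text \<open>
  Graphs here are simple and undirected: an edge is a two-element vertex set.
  The notion \<open>spanning_tree\<close> of the AFP entry Graph_Theory is not used: it only forbids
  directed cycles, so an oriented triangle without a directed cycle counts as a tree there.
\<close>

definition complete_edges :: "'v set \<Rightarrow> 'v set set" where
  "complete_edges V = {e. e \<subseteq> V \<and> card e = 2}"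

definition connected_graph :: "'v set \<Rightarrow> 'v set set \<Rightarrow> bool" where
  "connected_graph V E \<longleftrightarrow> (\<forall>u\<in>V. \<forall>v\<in>V. (u, v) \<in> {(x, y). {x, y} \<in> E}\<^sup>*)"

definition is_cycle :: "'v set set \<Rightarrow> 'v list \<Rightarrow> bool" where
  "is_cycle E vs \<longleftrightarrow> length vs \<ge> 3 \<and> distinct vs \<and>
     (\<forall>i<length vs. {vs ! i, vs ! (Suc i mod length vs)} \<in> E)"

definition spanning_trees :: "'v set \<Rightarrow> 'v set set set" where
  "spanning_trees V =
     {T. T \<subseteq> complete_edges V \<and> connected_graph V T \<and> (\<nexists>vs. is_cycle T vs)}"

definition mst_weight :: "'v set \<Rightarrow> ('v set \<Rightarrow> real) \<Rightarrow> real" where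
  "mst_weight V w = Min ((\<lambda>T. \<Sum>e\<in>T. w e) ` spanning_trees V)"

text \<open>
  The minimum above is over a finite set, nonempty whenever \<open>V\<close> is nonempty.
\<close>

lemma finite_spanning_trees:
  assumes "finite V"
  shows "finite (spanning_trees V)"
proof -
  have "complete_edges V \<subseteq> Pow V"
    by (auto simp: complete_edges_def)
  then have "finite (complete_edges V)"
    using assms finite_subset by blast
  moreover have "spanning_trees V \<subseteq> Pow (complete_edges V)"
    by (auto simp: spanning_trees_def)
  ultimately show ?thesis
    using finite_subset by blast
qed

lemma spanning_trees_nonempty:
  assumes "c \<in> V"
  shows "spanning_trees V \<noteq> {}"
proof -
  define T where "T = {{c, v} |v. v \<in> V \<and> v \<noteq> c}"
  have sub: "T \<subseteq> complete_edges V"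
    using assms by (auto simp: T_def complete_edges_def card_insert_if)
  have "connected_graph V T"
    unfolding connected_graph_def
  proof (intro ballI)
    fix u v assume uv: "u \<in> V" "v \<in> V"
    let ?R = "{(x, y). {x, y} \<in> T}"
    have "(u, c) \<in> ?R\<^sup>*"
      using uv by (cases "u = c") (auto simp: T_def insert_commute intro!: r_into_rtrancl)
    moreover have "(c, v) \<in> ?R\<^sup>*"
      using uv by (cases "v = c") (auto simp: T_def intro!: r_into_rtrancl)
    ultimately show "(u, v) \<in> ?R\<^sup>*"
      by (rule rtrancl_trans)
  qed
  moreover have "\<not> is_cycle T vs" for vs
  proof
    assume cyc: "is_cycle T vs"
    have star: "x = c \<or> y = c" if "{x, y} \<in> T" for x y
      using that by (auto simp: T_def doubleton_eq_iff)
    have dist: "distinct vs" and len: "3 \<le> length vs"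
      and e: "\<And>i. i < length vs \<Longrightarrow> {vs ! i, vs ! (Suc i mod length vs)} \<in> T"
      using cyc by (auto simp: is_cycle_def)
    have pos: "0 < length vs" "1 < length vs" "Suc 0 mod length vs = 1" "Suc 1 mod length vs = 2"
      using len by auto
    have e01: "vs ! 0 = c \<or> vs ! 1 = c"
      using star[OF e[OF pos(1)]] pos(3) by simp
    have e12: "vs ! 1 = c \<or> vs ! 2 = c"
      using star[OF e[OF pos(2)]] unfolding pos(4) .
    define k where "k = length vs - 1"
    have "Suc k = length vs"
      using len by (auto simp: k_def)
    then have k: "k < length vs" "Suc k mod length vs = 0" "k \<noteq> 0" "k \<noteq> 1"
      using len by auto
    have ek: "vs ! k = c \<or> vs ! 0 = c"
      using star[OF e[OF k(1)]] k(2) by simp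
    have "2 < length vs"
      using len by simp
    then have "vs ! 0 \<noteq> vs ! 1" "vs ! 0 \<noteq> vs ! 2" "vs ! 1 \<noteq> vs ! k" "vs ! 0 \<noteq> vs ! k"
      using k pos dist by (simp_all only: nth_eq_iff_index_eq)
    then show False
      using e01 e12 ek by metis
  qed
  ultimately have "T \<in> spanning_trees V"
    using sub by (simp add: spanning_trees_def)
  then show ?thesis by blast
qed

definition unit_square :: "(real ^ 2) set" where
  "unit_square = cbox 0 1"

text \<open>
  The vertices of \<open>K\<^sub>n\<close> are the indices \<open>1, \<dots>, n\<close>, with vertex \<open>i\<close> placed at the point
  \<open>x i\<close>. As \<open>h\<close> is only assumed symmetric on the unit square, which contains all the
  nodes only almost surely, the endpoints of an edge are taken in increasing index order.
\<close>

definition edge_weight ::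
  "real \<Rightarrow> (real ^ 2 \<Rightarrow> real ^ 2 \<Rightarrow> real) \<Rightarrow> (nat \<Rightarrow> real ^ 2) \<Rightarrow> nat set \<Rightarrow> real" where
  "edge_weight \<alpha> h x e = h (x (Min e)) (x (Max e)) powr \<alpha>"

definition MST :: "real \<Rightarrow> (real ^ 2 \<Rightarrow> real ^ 2 \<Rightarrow> real) \<Rightarrow> (nat \<Rightarrow> real ^ 2) \<Rightarrow> nat \<Rightarrow> real" where
  "MST \<alpha> h x n = mst_weight {1..n} (edge_weight \<alpha> h x)"

end

theory Submission
  imports Defs "HOL-Real_Asymp.Real_Asymp"
begin

text \<open>
  Write \<open>r\<^sub>n\<close> for the mean tree weight divided by \<open>n\<close> to the power \<open>1 - \<alpha>/2\<close>. The heart of the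
  matter is a comparison of two sizes \<open>m\<close> and \<open>n\<close>, with \<open>n\<close> much larger than \<open>m\<close>. Cut the
  square into \<open>k * k\<close> equal cells, where \<open>k\<close> is such that a cell expects slightly more than
  \<open>m\<close> of the \<open>n\<close> points. Nearly every cell then contains at least \<open>m\<close> points, and the first \<open>m\<close>
  of them are independent and uniform in the cell. By (b1) and (b2), a minimum spanning tree on
  them costs on average at most \<open>h0 powr \<alpha> * k powr (- \<alpha>)\<close> times the mean tree weight on \<open>m\<close>
  uniform points of the whole square (\<open>nn_integral_cell_trees_le\<close>). Up to the ratio
  \<open>(k * k * m / n) powr (1 - \<alpha>/2)\<close>, which is close to one, the cell trees
  contribute \<open>h0 powr \<alpha> * r\<^sub>m\<close> to \<open>r\<^sub>n\<close>.

  It remains to glue the cell trees and the leftover points together at negligible cost, for every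
  \<open>\<alpha> > 0\<close>. Joining neighbouring cells by arbitrary edges is too expensive for large \<open>\<alpha>\<close>, since
  such edges can be as long as a cell. Instead, order the points by their sup norm (their
  sup-norm distance to a corner of the square) and attach every leftover point, and the lowest
  point of every cell tree, to a nearby lower point. Following these edges downwards leads to the
  lowest point of all, so the resulting graph is connected (\<open>mst_weight_le_glued\<close>). The points
  lower than a given point \<open>p\<close> fill a square having \<open>p\<close> on its boundary, and this square contains
  a square of side \<open>t\<close> close to \<open>p\<close>, for every \<open>t\<close> up to the size of the square. Hence the distance
  from \<open>p\<close> to its nearest lower point has Gaussian tails on the scale \<open>n powr (-1/2)\<close>
  (\<open>emeasure_lonely_le\<close>), and \<open>j\<close> such edges cost about \<open>j * n powr (- \<alpha>/2)\<close>. Which points have to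
  be attached depends on the configuration, so costs and selection are dependent; they are
  separated by \<open>y \<le> \<epsilon> * y^2 + 1/\<epsilon>\<close> (\<open>cheap_lower_neighbour\<close>), where the squares are
  summed over all points and \<open>1/\<epsilon>\<close> only over the attached ones. The expected fraction of
  attached points is small by an exponential moment bound on the occupation of a cell.

  Letting first \<open>n\<close> and then \<open>m\<close> tend to infinity gives the comparison of the upper and lower limits
  (\<open>limsup_normalized_le_liminf\<close>). The same gluing inequality without any cells, all points being
  attached, bounds \<open>r\<^sub>n\<close> from above. For the bound from below, a spanning tree on \<open>n\<close> points has at
  least \<open>n/2\<close> edges, while on average at most \<open>n/4\<close> pairs of points are at distance below a small
  multiple of \<open>n powr (-1/2)\<close> (\<open>mean_mst_lower\<close>).
\<close>

section \<open>Spanning trees inside connected graphs\<close>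

definition adj :: "'v set set \<Rightarrow> ('v \<times> 'v) set" where
  "adj E = {(x, y). {x, y} \<in> E}"

lemma adj_iff: "(x, y) \<in> adj E \<longleftrightarrow> {x, y} \<in> E"
  by (simp add: adj_def)

lemma connected_graph_adj: "connected_graph V E \<longleftrightarrow> (\<forall>u\<in>V. \<forall>v\<in>V. (u, v) \<in> (adj E)\<^sup>*)"
  by (simp add: connected_graph_def adj_def)

lemma adj_rtrancl_sym: "(x, y) \<in> (adj E)\<^sup>* \<Longrightarrow> (y, x) \<in> (adj E)\<^sup>*"
proof -
  have "sym (adj E)"
    by (auto simp: sym_def adj_def insert_commute)
  then show "(x, y) \<in> (adj E)\<^sup>* \<Longrightarrow> (y, x) \<in> (adj E)\<^sup>*"
    using sym_rtrancl symD by metis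
qed

lemma adj_rtrancl_mono: "E \<subseteq> F \<Longrightarrow> (x, y) \<in> (adj E)\<^sup>* \<Longrightarrow> (x, y) \<in> (adj F)\<^sup>*"
  using rtrancl_mono[of "adj E" "adj F"] by (auto simp: adj_def)

lemma finite_complete_edges: "finite V \<Longrightarrow> finite (complete_edges V)"
  by (rule finite_subset[of _ "Pow V"]) (auto simp: complete_edges_def)

lemma complete_edges_mono: "U \<subseteq> V \<Longrightarrow> complete_edges U \<subseteq> complete_edges V"
  by (auto simp: complete_edges_def)

text \<open>
  The rest of the cycle is a path between the endpoints of the removed edge.
\<close>

lemma connected_graph_remove_cycle_edge:
  assumes conn: "connected_graph V E" and cyc: "is_cycle E vs"
  obtains e where "e \<in> E" "connected_graph V (E - {e})"
proof -
  define L where "L = length vs"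
  have L: "L \<ge> 3" and dist: "distinct vs"
    and ed: "\<And>i. i < L \<Longrightarrow> {vs ! i, vs ! (Suc i mod L)} \<in> E"
    using cyc by (auto simp: is_cycle_def L_def)
  define e where "e = {vs ! (L - 1), vs ! 0}"
  have "Suc (L - 1) mod L = 0"
    using L by simp
  then have eE: "e \<in> E"
    using ed[of "L - 1"] L by (simp add: e_def)
  have nth_eq: "vs ! i = vs ! j \<longleftrightarrow> i = j" if "i < L" "j < L" for i j
    using that dist by (simp add: nth_eq_iff_index_eq L_def)
  have path: "(vs ! 0, vs ! i) \<in> (adj (E - {e}))\<^sup>*" if "i < L" for i
    using that
  proof (induction i)
    case (Suc i)
    have "{vs ! i, vs ! Suc i} \<in> E"
      using ed[of i] Suc.prems by simp
    moreover have "{vs ! i, vs ! Suc i} \<noteq> e"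
      using Suc.prems L by (auto simp: e_def doubleton_eq_iff nth_eq)
    ultimately have "(vs ! i, vs ! Suc i) \<in> adj (E - {e})"
      by (simp add: adj_iff)
    with Suc show ?case
      by (meson Suc_lessD rtrancl.rtrancl_into_rtrancl)
  qed auto
  have "(x, y) \<in> (adj (E - {e}))\<^sup>*" if "(x, y) \<in> adj E" for x y
  proof (cases "{x, y} = e")
    case True
    have p: "(vs ! 0, vs ! (L - 1)) \<in> (adj (E - {e}))\<^sup>*"
      using path[of "L - 1"] L by simp
    from True have "(x = vs ! 0 \<and> y = vs ! (L - 1)) \<or> (y = vs ! 0 \<and> x = vs ! (L - 1))"
      by (auto simp: e_def doubleton_eq_iff)
    then show ?thesis
      using p adj_rtrancl_sym[OF p] by auto
  next
    case False
    then show ?thesis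
      using that by (intro r_into_rtrancl) (simp add: adj_iff)
  qed
  then have "(adj E)\<^sup>* \<subseteq> (adj (E - {e}))\<^sup>*"
    by (intro rtrancl_subset_rtrancl) auto
  then have "connected_graph V (E - {e})"
    using conn unfolding connected_graph_adj by blast
  with eE that show ?thesis by blast
qed

lemma connected_graph_contains_spanning_tree:
  assumes "finite E" "E \<subseteq> complete_edges V" "connected_graph V E"
  shows "\<exists>T\<subseteq>E. T \<in> spanning_trees V"
  using assms
proof (induction "card E" arbitrary: E rule: less_induct)
  case less
  show ?case
  proof (cases "\<exists>vs. is_cycle E vs")
    case True
    then obtain vs where "is_cycle E vs" by blast
    then obtain e where e: "e \<in> E" "connected_graph V (E - {e})"
      using connected_graph_remove_cycle_edge less.prems(3) by blast
    have "card (E - {e}) < card E"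
      using e less.prems(1) by (meson card_Diff1_less)
    then have "\<exists>T\<subseteq>E - {e}. T \<in> spanning_trees V"
      using less.hyps[of "E - {e}"] less.prems e by blast
    then show ?thesis by blast
  next
    case False
    then show ?thesis
      using less.prems by (auto simp: spanning_trees_def)
  qed
qed

text \<open>
  With nonnegative weights an upper bound for the minimum needs only a connected edge set, which may
  contain cycles.
\<close>

lemma mst_weight_le_connected:
  assumes V: "finite V" and E: "E \<subseteq> complete_edges V" "connected_graph V E"
    and w: "\<And>e. e \<in> E \<Longrightarrow> 0 \<le> w e"
  shows "mst_weight V w \<le> (\<Sum>e\<in>E. w e)"
proof -
  have finE: "finite E"
    using V E finite_complete_edges finite_subset by blast
  obtain T where T: "T \<subseteq> E" "T \<in> spanning_trees V"
    using connected_graph_contains_spanning_tree[OF finE E] by blast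
  have "mst_weight V w \<le> (\<Sum>e\<in>T. w e)"
    unfolding mst_weight_def using T finite_spanning_trees[OF V] by (intro Min_le) auto
  also have "\<dots> \<le> (\<Sum>e\<in>E. w e)"
    using T finE w by (intro sum_mono2) auto
  finally show ?thesis .
qed

lemma mst_weight_attained:
  assumes "finite V" "V \<noteq> {}"
  obtains T where "T \<in> spanning_trees V" "mst_weight V w = (\<Sum>e\<in>T. w e)"
proof -
  obtain c where "c \<in> V"
    using assms(2) by auto
  then have "spanning_trees V \<noteq> {}"
    by (rule spanning_trees_nonempty)
  then have "mst_weight V w \<in> (\<lambda>T. \<Sum>e\<in>T. w e) ` spanning_trees V"
    unfolding mst_weight_def using assms by (intro Min_in) (auto intro: finite_spanning_trees)
  then show ?thesis using that by auto
qed

lemma spanning_tree_edgeD: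
  "T \<in> spanning_trees V \<Longrightarrow> e \<in> T \<Longrightarrow> e \<in> complete_edges V"
  by (auto simp: spanning_trees_def)

lemma mst_weight_nonneg:
  assumes "finite V" "V \<noteq> {}" "\<And>e. 0 \<le> w e"
  shows "0 \<le> mst_weight V w"
proof -
  obtain T where "T \<in> spanning_trees V" "mst_weight V w = (\<Sum>e\<in>T. w e)"
    using mst_weight_attained[OF assms(1,2)] .
  then show ?thesis
    by (simp add: assms(3) sum_nonneg)
qed

lemma mst_weight_le_scaled:
  assumes V: "finite V" "V \<noteq> {}"
    and le: "\<And>e. e \<in> complete_edges V \<Longrightarrow> w e \<le> c * w' e"
  shows "mst_weight V w \<le> c * mst_weight V w'"
proof -
  obtain T where T: "T \<in> spanning_trees V" "mst_weight V w' = (\<Sum>e\<in>T. w' e)"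
    using mst_weight_attained[OF V] .
  have "mst_weight V w \<le> (\<Sum>e\<in>T. w e)"
    unfolding mst_weight_def using T finite_spanning_trees[OF V(1)] by (intro Min_le) auto
  also have "\<dots> \<le> (\<Sum>e\<in>T. c * w' e)"
    using T by (intro sum_mono le) (auto dest: spanning_tree_edgeD)
  finally show ?thesis
    by (simp add: T(2) sum_distrib_left)
qed

lemma mst_weight_cong:
  assumes "\<And>e. e \<in> complete_edges V \<Longrightarrow> w e = w' e"
  shows "mst_weight V w = mst_weight V w'"
proof -
  have "(\<lambda>T. \<Sum>e\<in>T. w e) ` spanning_trees V = (\<lambda>T. \<Sum>e\<in>T. w' e) ` spanning_trees V"
    by (intro image_cong sum.cong refl assms) (rule spanning_tree_edgeD)
  then show ?thesis
    by (simp add: mst_weight_def)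
qed

section \<open>Gluing trees along an order\<close>

text \<open>
  The tie-break by the label makes this a total order on the labels for every \<open>\<rho>\<close>, so that
  coinciding values need no almost-sure argument.
\<close>

definition lower :: "('v::linorder \<Rightarrow> real) \<Rightarrow> 'v \<Rightarrow> 'v \<Rightarrow> bool" where
  "lower \<rho> j i \<longleftrightarrow> \<rho> j < \<rho> i \<or> (\<rho> j = \<rho> i \<and> j < i)"

lemma lower_trans: "lower \<rho> i j \<Longrightarrow> lower \<rho> j k \<Longrightarrow> lower \<rho> i k"
  by (auto simp: lower_def)

lemma lower_irrefl: "\<not> lower \<rho> i i"
  by (auto simp: lower_def)

definition lowest :: "('v::linorder \<Rightarrow> real) \<Rightarrow> 'v set \<Rightarrow> 'v" where
  "lowest \<rho> A = (SOME a. a \<in> A \<and> (\<forall>b\<in>A. b = a \<or> lower \<rho> a b))"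

lemma lowest:
  assumes "finite A" "A \<noteq> {}"
  shows "lowest \<rho> A \<in> A" "\<And>b. b \<in> A \<Longrightarrow> b \<noteq> lowest \<rho> A \<Longrightarrow> lower \<rho> (lowest \<rho> A) b"
proof -
  define r where "r = Min (\<rho> ` A)"
  define a where "a = Min {b \<in> A. \<rho> b = r}"
  have "r \<in> \<rho> ` A"
    using assms by (auto simp: r_def)
  then have "a \<in> {b \<in> A. \<rho> b = r}"
    unfolding a_def using assms by (intro Min_in) auto
  moreover have "b = a \<or> lower \<rho> a b" if "b \<in> A" for b
  proof -
    have "r \<le> \<rho> b"
      using that assms by (auto simp: r_def)
    moreover have "a \<le> b" if "\<rho> b = r"
      using that \<open>b \<in> A\<close> assms by (auto simp: a_def)
    ultimately show ?thesis
      using \<open>a \<in> {b \<in> A. \<rho> b = r}\<close> by (auto simp: lower_def less_le)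
  qed
  ultimately have "\<exists>a. a \<in> A \<and> (\<forall>b\<in>A. b = a \<or> lower \<rho> a b)"
    by blast
  then have "lowest \<rho> A \<in> A \<and> (\<forall>b\<in>A. b = lowest \<rho> A \<or> lower \<rho> (lowest \<rho> A) b)"
    unfolding lowest_def by (rule someI_ex)
  then show "lowest \<rho> A \<in> A" "\<And>b. b \<in> A \<Longrightarrow> b \<noteq> lowest \<rho> A \<Longrightarrow> lower \<rho> (lowest \<rho> A) b"
    by auto
qed

lemma sum_le_sum_UNION:
  fixes w :: "'b \<Rightarrow> real"
  assumes "finite K" "\<And>q. q \<in> K \<Longrightarrow> finite (T q)" "\<And>e. 0 \<le> w e"
  shows "(\<Sum>e\<in>\<Union> (T ` K). w e) \<le> (\<Sum>q\<in>K. \<Sum>e\<in>T q. w e)"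
  using assms(1,2)
proof (induction K rule: finite_induct)
  case (insert q K)
  have "(\<Sum>e\<in>T q \<union> \<Union> (T ` K). w e) \<le> (\<Sum>e\<in>T q. w e) + (\<Sum>e\<in>\<Union> (T ` K). w e)"
    using insert sum_nonneg[of "T q \<inter> \<Union> (T ` K)" w] assms(3) by (subst sum_Un) auto
  with insert show ?case by auto
qed auto

text \<open>
  The edges at the points of \<open>U\<close> lead downwards, and inside a tree every point is joined to the
  lowest one, which lies in \<open>U\<close>. A lowest point that is not joined to the root is
  therefore impossible.
\<close>

lemma mst_weight_le_glued:
  fixes V :: "'v::linorder set" and G :: "'q \<Rightarrow> 'v set"
  assumes V: "finite V" "V \<noteq> {}" and K: "finite K"
    and G: "\<And>q. q \<in> K \<Longrightarrow> G q \<subseteq> V \<and> G q \<noteq> {}"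
    and w: "\<And>e. 0 \<le> w e"
    and U: "U \<subseteq> V" "V \<subseteq> U \<union> \<Union> (G ` K)" "\<And>q. q \<in> K \<Longrightarrow> lowest \<rho> (G q) \<in> U"
    and nb: "\<And>i. i \<in> U \<Longrightarrow> i \<noteq> lowest \<rho> V \<Longrightarrow> nb i \<in> V \<and> lower \<rho> (nb i) i"
  shows "mst_weight V w \<le> (\<Sum>q\<in>K. mst_weight (G q) w) + (\<Sum>i\<in>U - {lowest \<rho> V}. w {i, nb i})"
proof -
  define root where "root = lowest \<rho> V"
  have finG: "finite (G q)" if "q \<in> K" for q
    using G[OF that] V(1) finite_subset by blast
  have "\<forall>q\<in>K. \<exists>T. T \<in> spanning_trees (G q) \<and> mst_weight (G q) w = (\<Sum>e\<in>T. w e)"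
    using mst_weight_attained[OF finG conjunct2[OF G]] by metis
  then obtain T where T: "\<And>q. q \<in> K \<Longrightarrow> T q \<in> spanning_trees (G q)"
      "\<And>q. q \<in> K \<Longrightarrow> mst_weight (G q) w = (\<Sum>e\<in>T q. w e)"
    by metis
  have finT: "finite (T q)" if "q \<in> K" for q
    using T(1)[OF that] finite_complete_edges[OF finG[OF that]] finite_subset
    by (auto simp: spanning_trees_def)
  define N where "N = (\<lambda>i. {i, nb i}) ` (U - {root})"
  define E where "E = \<Union> (T ` K) \<union> N"
  have finU: "finite U"
    using U(1) V(1) finite_subset by blast
  have TV: "T q \<subseteq> complete_edges V" if "q \<in> K" for q
    using T(1)[OF that] complete_edges_mono[of "G q" V] G[OF that] by (auto simp: spanning_trees_def)
  have "{i, nb i} \<in> complete_edges V" if "i \<in> U - {root}" for i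
  proof -
    have "nb i \<noteq> i"
      using nb[of i] that lower_irrefl[of \<rho> i] by (auto simp: root_def)
    then show ?thesis
      using nb[of i] that U(1) by (auto simp: complete_edges_def root_def)
  qed
  then have EV: "E \<subseteq> complete_edges V"
    using TV by (auto simp: E_def N_def)
  have to_root: "(root, v) \<in> (adj E)\<^sup>*" if "v \<in> V" for v
  proof (rule ccontr)
    assume v: "(root, v) \<notin> (adj E)\<^sup>*"
    define B where "B = {v \<in> V. (root, v) \<notin> (adj E)\<^sup>*}"
    have B: "finite B" "B \<noteq> {}"
      using v that V by (auto simp: B_def)
    define b where "b = lowest \<rho> B"
    have bB: "b \<in> B" "\<And>c. c \<in> B \<Longrightarrow> c \<noteq> b \<Longrightarrow> lower \<rho> b c"
      using lowest[OF B, where \<rho> = \<rho>] by (auto simp: b_def)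
    have good: "(root, c) \<in> (adj E)\<^sup>*" if "c \<in> V" "lower \<rho> c b" for c
      using that bB(2)[of c] lower_trans[of \<rho> c b c] lower_irrefl[of \<rho>] by (auto simp: B_def)
    have "b \<noteq> root"
      using bB(1) by (auto simp: B_def)
    show False
    proof (cases "b \<in> U")
      case True
      then have "nb b \<in> V" "lower \<rho> (nb b) b"
        using nb[of b] \<open>b \<noteq> root\<close> by (auto simp: root_def)
      then have "(root, nb b) \<in> (adj E)\<^sup>*"
        using good by blast
      moreover have "(nb b, b) \<in> adj E"
        using True \<open>b \<noteq> root\<close> by (auto simp: adj_iff E_def N_def insert_commute)
      ultimately show False
        using bB(1) rtrancl_into_rtrancl[of root "nb b"] by (auto simp: B_def)
    next
      case False
      then obtain q where q: "q \<in> K" "b \<in> G q"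
        using U(2) bB(1) by (auto simp: B_def)
      define c where "c = lowest \<rho> (G q)"
      have c: "c \<in> G q" "c = b \<or> lower \<rho> c b"
        using lowest[OF finG[OF q(1)] conjunct2[OF G[OF q(1)]], where \<rho> = \<rho>] q(2)
        unfolding c_def by blast+
      have "c \<in> U"
        using U(3) q by (auto simp: c_def)
      with False have "lower \<rho> c b"
        using c by auto
      then have "(root, c) \<in> (adj E)\<^sup>*"
        using good c U(1) \<open>c \<in> U\<close> by blast
      moreover have "(c, b) \<in> (adj (T q))\<^sup>*"
        using T(1)[OF q(1)] c q by (auto simp: spanning_trees_def connected_graph_adj)
      then have "(c, b) \<in> (adj E)\<^sup>*"
        by (rule adj_rtrancl_mono[rotated]) (use q in \<open>auto simp: E_def\<close>)
      ultimately show False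
        using bB(1) by (auto simp: B_def dest: rtrancl_trans)
    qed
  qed
  have "connected_graph V E"
    unfolding connected_graph_adj
    by (blast intro: rtrancl_trans[OF adj_rtrancl_sym] to_root)
  then have "mst_weight V w \<le> (\<Sum>e\<in>E. w e)"
    using EV V w by (intro mst_weight_le_connected) auto
  also have "\<dots> \<le> (\<Sum>e\<in>\<Union> (T ` K). w e) + (\<Sum>e\<in>N. w e)"
  proof -
    have "finite E"
      using EV V finite_complete_edges finite_subset by blast
    then have "finite (\<Union> (T ` K))" "finite N"
      by (auto simp: E_def)
    then show ?thesis
      unfolding E_def using w sum_nonneg[of "\<Union> (T ` K) \<inter> N" w] by (subst sum_Un) auto
  qed
  also have "(\<Sum>e\<in>\<Union> (T ` K). w e) \<le> (\<Sum>q\<in>K. \<Sum>e\<in>T q. w e)"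
    using sum_le_sum_UNION[OF K] finT w by blast
  also have "(\<Sum>e\<in>N. w e) \<le> (\<Sum>i\<in>U - {root}. w {i, nb i})"
    unfolding N_def using sum_image_le[of "U - {root}" w "\<lambda>i. {i, nb i}"] finU w
    by (simp add: o_def)
  finally show ?thesis
    using T(2) by (simp add: root_def)
qed

section \<open>Independent uniform points\<close>

text \<open>
  The open square differs from \<open>unit_square\<close> by a null set. Having it as the whole space turns
  statements that would hold almost surely into pointwise ones, and makes the cells of a grid,
  again open squares, disjoint.
\<close>

definition unif :: "(real ^ 2) measure" where
  "unif = restrict_space lborel (box 0 1)"

lemma space_unif: "space unif = box 0 1"
  by (simp add: unif_def space_restrict_space)

lemma measurable_unif_borel: "(\<lambda>x. x) \<in> unif \<rightarrow>\<^sub>M borel"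
  unfolding unif_def by (rule measurable_restrict_space1) simp

lemma emeasure_unif: "A \<in> sets borel \<Longrightarrow> A \<subseteq> box 0 1 \<Longrightarrow> emeasure unif A = emeasure lborel A"
  by (simp add: unif_def emeasure_restrict_space)

lemma sets_unif: "A \<in> sets borel \<Longrightarrow> A \<subseteq> box 0 1 \<Longrightarrow> A \<in> sets unif"
  by (simp add: unif_def sets_restrict_space_iff)

lemma inner_one_Basis: "b \<in> Basis \<Longrightarrow> (1 :: real ^ 'n) \<bullet> b = 1"
  by (auto simp: Basis_vec_def inner_axis)

lemma emeasure_lborel_square:
  fixes a :: "real ^ 2"
  assumes "0 \<le> t"
  shows "emeasure lborel (box a (a + t *\<^sub>R 1)) = ennreal (t\<^sup>2)"
    and "emeasure lborel (cbox a (a + t *\<^sub>R 1)) = ennreal (t\<^sup>2)"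
proof -
  have *: "a \<bullet> b \<le> (a + t *\<^sub>R 1) \<bullet> b" "(a + t *\<^sub>R 1 - a) \<bullet> b = t" if "b \<in> Basis" for b
    using assms inner_one_Basis[OF that] by (auto simp: inner_add_left)
  have "(\<Prod>b\<in>Basis. (a + t *\<^sub>R 1 - a) \<bullet> b) = (\<Prod>b\<in>(Basis :: (real ^ 2) set). t)"
    by (intro prod.cong refl *(2))
  then have "(\<Prod>b\<in>Basis. (a + t *\<^sub>R 1 - a) \<bullet> b) = t\<^sup>2"
    by simp
  then show "emeasure lborel (box a (a + t *\<^sub>R 1)) = ennreal (t\<^sup>2)"
      "emeasure lborel (cbox a (a + t *\<^sub>R 1)) = ennreal (t\<^sup>2)"
    using emeasure_lborel_box[OF *(1)] emeasure_lborel_cbox[OF *(1)] by simp_all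
qed

lemma emeasure_unit_box: "emeasure lborel (box 0 (1 :: real ^ 2)) = 1"
    "emeasure lborel (cbox 0 (1 :: real ^ 2)) = 1"
  using emeasure_lborel_square[of 1 "0 :: real ^ 2"] by simp_all

lemma prob_space_unif: "prob_space unif"
  by standard (simp add: emeasure_unif space_unif emeasure_unit_box)

lemma product_sigma_finite_unif: "product_sigma_finite (\<lambda>_. unif)"
  by (simp add: product_sigma_finite_def prob_space_imp_sigma_finite prob_space_unif)

abbreviation unif_points :: "'i set \<Rightarrow> ('i \<Rightarrow> real ^ 2) measure" where
  "unif_points I \<equiv> PiM I (\<lambda>_. unif)"

lemma prob_space_PiM_unif: "prob_space (unif_points I)"
  by (intro prob_space_PiM prob_space_unif)

lemma emeasure_PiM_unif_space: "emeasure (unif_points I) (space (unif_points I)) = 1"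
  by (intro prob_space.emeasure_space_1 prob_space_PiM_unif)

lemma measurable_PiM_unif_component:
  "i \<in> I \<Longrightarrow> (\<lambda>x. x i) \<in> unif_points I \<rightarrow>\<^sub>M borel"
  by (rule measurable_compose[OF _ measurable_unif_borel]) (rule measurable_component_singleton)

lemma measurable_PiM_unif_indicator [measurable]:
  "i \<in> I \<Longrightarrow> Q \<in> sets borel
    \<Longrightarrow> (\<lambda>x. indicator Q (x i) :: ennreal) \<in> borel_measurable (unif_points I)"
  by (rule measurable_compose[OF measurable_PiM_unif_component]) auto

lemma space_PiM_unifD: "x \<in> space (unif_points I) \<Longrightarrow> i \<in> I \<Longrightarrow> x i \<in> box 0 1"
  by (auto simp: space_PiM space_unif PiE_iff)

lemma uniform_measure_unit_square:
  "uniform_measure lborel unit_square = distr unif borel (\<lambda>x. x)"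
proof (rule measure_eqI)
  fix A assume "A \<in> sets (uniform_measure lborel unit_square)"
  then have A [measurable]: "A \<in> sets borel"
    by simp
  have "emeasure lborel (cbox 0 1 - box 0 (1 :: real ^ 2)) = 0"
    by (subst emeasure_Diff) (auto simp: emeasure_unit_box box_subset_cbox)
  then have "cbox 0 1 - box 0 (1 :: real ^ 2) \<in> null_sets lborel"
    by auto
  then have "AE x in lborel. x \<notin> cbox 0 1 - box 0 (1 :: real ^ 2)"
    by (rule AE_not_in)
  then have "AE x in lborel. x \<in> cbox 0 1 \<inter> A \<longleftrightarrow> x \<in> box 0 (1 :: real ^ 2) \<inter> A"
    by eventually_elim (use box_subset_cbox[of 0 "1 :: real ^ 2"] in auto)
  then have "emeasure lborel (cbox 0 1 \<inter> A) = emeasure lborel (box 0 1 \<inter> A)"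
    by (intro emeasure_eq_AE) auto
  moreover have "emeasure (distr unif borel (\<lambda>x. x)) A = emeasure lborel (box 0 1 \<inter> A)"
    by (subst emeasure_distr)
      (auto simp: space_unif emeasure_unif Int_commute measurable_unif_borel)
  ultimately show "emeasure (uniform_measure lborel unit_square) A
      = emeasure (distr unif borel (\<lambda>x. x)) A"
    by (simp add: unit_square_def emeasure_unit_box divide_ennreal_def)
qed simp

section \<open>Restriction to a cell and rescaling\<close>

definition cellmap :: "nat \<Rightarrow> real ^ 2 \<Rightarrow> real ^ 2 \<Rightarrow> real ^ 2" where
  "cellmap k b u = (1 / real k) *\<^sub>R (b + u)"

definition cell :: "nat \<Rightarrow> real ^ 2 \<Rightarrow> (real ^ 2) set" where
  "cell k b = box (cellmap k b 0) (cellmap k b 1)"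

lemma cellmap_in_cell_iff: "0 < k \<Longrightarrow> cellmap k b u \<in> cell k b \<longleftrightarrow> u \<in> box 0 1"
  by (simp add: cell_def cellmap_def mem_box_cart field_simps)

lemma cell_sets [measurable]: "cell k b \<in> sets borel"
  by (simp add: cell_def)

lemma cellmap_measurable: "cellmap k b \<in> borel \<rightarrow>\<^sub>M borel"
  unfolding cellmap_def[abs_def] by (intro borel_measurable_scaleR borel_measurable_add) simp_all

lemma cellmap_measurable_unif:
  assumes "0 < k" "cell k b \<subseteq> box 0 1"
  shows "cellmap k b \<in> unif \<rightarrow>\<^sub>M unif"
proof -
  have "cellmap k b \<in> unif \<rightarrow>\<^sub>M borel"
    by (rule measurable_compose[OF measurable_unif_borel cellmap_measurable])
  then have "cellmap k b \<in> unif \<rightarrow>\<^sub>M lborel"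
    by (simp only: measurable_lborel1)
  moreover have "cellmap k b \<in> space unif \<rightarrow> box 0 1"
    using assms cellmap_in_cell_iff[OF assms(1), of b] by (auto simp: space_unif)
  ultimately have "cellmap k b \<in> unif \<rightarrow>\<^sub>M restrict_space lborel (box 0 1)"
    by (intro measurable_restrict_space2)
  then show ?thesis
    by (simp only: unif_def)
qed

text \<open>
  Restricted to a cell, the uniform distribution is the image of itself under \<open>cellmap\<close>, multiplied
  by the area of the cell. The lemma after it applies this to one coordinate after the other.
\<close>

lemma nn_integral_unif_cell:
  assumes k: "0 < k" and sub: "cell k b \<subseteq> box 0 1" and f: "f \<in> borel_measurable unif"
  shows "(\<integral>\<^sup>+x. f x * indicator (cell k b) x \<partial>unif)
    = ennreal (1 / (real k)\<^sup>2) * (\<integral>\<^sup>+u. f (cellmap k b u) \<partial>unif)"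
proof -
  have f' [measurable]: "(\<lambda>x. f x * indicator (box 0 1) x) \<in> borel_measurable borel"
    using f unfolding unif_def by (subst (asm) borel_measurable_restrict_space_iff_ennreal) auto
  define g where "g = (\<lambda>x. f x * indicator (box 0 1) x * indicator (cell k b) x)"
  have g [measurable]: "g \<in> borel_measurable borel"
    unfolding g_def by measurable
  have "(\<integral>\<^sup>+x. f x * indicator (cell k b) x \<partial>unif) = (\<integral>\<^sup>+x. g x \<partial>lborel)"
    unfolding unif_def g_def
    by (subst nn_integral_restrict_space) (auto simp: mult_ac)
  also have "\<dots> = (\<integral>\<^sup>+x. ennreal (1 / (real k)\<^sup>2) * g (cellmap k b x) \<partial>lborel)"
  proof -
    have aff: "(lborel :: (real ^ 2) measure)
        = density (distr lborel borel (cellmap k b)) (\<lambda>_. ennreal (1 / (real k)\<^sup>2))"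
      using lborel_affine[of "1 / real k" "(1 / real k) *\<^sub>R b"] k
      by (simp add: cellmap_def[abs_def] scaleR_add_right power_divide)
    have "(\<integral>\<^sup>+x. g x \<partial>lborel)
        = (\<integral>\<^sup>+x. g x \<partial>density (distr lborel borel (cellmap k b)) (\<lambda>_. ennreal (1 / (real k)\<^sup>2)))"
      by (rule arg_cong[OF aff, where f = "\<lambda>M. \<integral>\<^sup>+x. g x \<partial>M"])
    also have "\<dots> = (\<integral>\<^sup>+x. ennreal (1 / (real k)\<^sup>2) * g (cellmap k b x) \<partial>lborel)"
    proof -
      have "(\<integral>\<^sup>+x. g x \<partial>density (distr lborel borel (cellmap k b)) (\<lambda>_. ennreal (1 / (real k)\<^sup>2)))
        = (\<integral>\<^sup>+x. ennreal (1 / (real k)\<^sup>2) * g x \<partial>distr lborel borel (cellmap k b))"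
        by (rule nn_integral_density) (use g cellmap_measurable in simp_all)
      also have "\<dots> = (\<integral>\<^sup>+x. ennreal (1 / (real k)\<^sup>2) * g (cellmap k b x) \<partial>lborel)"
        by (rule nn_integral_distr) (use g cellmap_measurable in simp_all)
      finally show ?thesis .
    qed
    finally show ?thesis .
  qed
  also have "\<dots> = ennreal (1 / (real k)\<^sup>2) * (\<integral>\<^sup>+x. g (cellmap k b x) \<partial>lborel)"
    by (rule nn_integral_cmult)
      (use measurable_compose[OF cellmap_measurable g] in simp)
  also have "(\<integral>\<^sup>+x. g (cellmap k b x) \<partial>lborel) = (\<integral>\<^sup>+u. f (cellmap k b u) \<partial>unif)"
  proof -
    have "cellmap k b u \<in> box 0 1" if "u \<in> box 0 1" for u
      using that sub cellmap_in_cell_iff[OF k, of b u] by auto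
    then show ?thesis
      unfolding unif_def
      by (subst nn_integral_restrict_space)
        (auto simp: g_def indicator_def cellmap_in_cell_iff[OF k] intro!: nn_integral_cong)
  qed
  finally show ?thesis .
qed

lemma nn_integral_PiM_unif_cell:
  fixes F :: "('i \<Rightarrow> real ^ 2) \<Rightarrow> ennreal"
  assumes k: "0 < k" and sub: "cell k b \<subseteq> box 0 1" and I: "finite I"
    and F: "F \<in> borel_measurable (unif_points I)"
  shows "(\<integral>\<^sup>+x. F x * (\<Prod>i\<in>I. indicator (cell k b) (x i)) \<partial>unif_points I)
    = ennreal (1 / (real k)\<^sup>2) ^ card I
      * (\<integral>\<^sup>+u. F (\<lambda>i\<in>I. cellmap k b (u i)) \<partial>unif_points I)"
  using I F
proof (induction I arbitrary: F rule: finite_induct)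
  case empty
  have "(\<integral>\<^sup>+x. F x \<partial>unif_points {}) = (\<integral>\<^sup>+u. F (\<lambda>i\<in>{}. cellmap k b (u i)) \<partial>unif_points {})"
    by (intro nn_integral_cong arg_cong[where f = F]) (auto simp: space_PiM)
  then show ?case
    by (simp only: prod.empty card.empty power_0 mult_1_left mult_1_right)
next
  case (insert i I)
  note insert.prems [measurable] insert.hyps [simp]
  define p where "p = ennreal (1 / (real k)\<^sup>2)"
  define \<phi> where "\<phi> = cellmap k b"
  have [measurable]: "cell k b \<in> sets unif"
    by (rule sets_unif[OF cell_sets sub])
  have [measurable]: "\<phi> \<in> unif \<rightarrow>\<^sub>M unif"
    unfolding \<phi>_def by (rule cellmap_measurable_unif[OF k sub])
  interpret unif: prob_space unif
    by (rule prob_space_unif)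
  define H where "H = (\<lambda>x. \<integral>\<^sup>+y. F (x(i := \<phi> y)) \<partial>unif)"
  have [measurable]: "H \<in> borel_measurable (unif_points I)"
    unfolding H_def by measurable
  have prod_eq: "(\<Prod>j\<in>I. indicator (cell k b) ((x(i := y)) j)) = (\<Prod>j\<in>I. indicator (cell k b) (x j) :: ennreal)"
    for x y by (intro prod.cong) (use insert.hyps in auto)
  have "(\<integral>\<^sup>+x. F x * (\<Prod>j\<in>insert i I. indicator (cell k b) (x j)) \<partial>unif_points (insert i I))
    = (\<integral>\<^sup>+x. \<integral>\<^sup>+y. (F (x(i := y)) * indicator (cell k b) y) * (\<Prod>j\<in>I. indicator (cell k b) (x j)) \<partial>unif \<partial>unif_points I)"
  proof (subst product_sigma_finite.product_nn_integral_insert[OF product_sigma_finite_unif insert.hyps])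
    show "(\<lambda>x. F x * (\<Prod>j\<in>insert i I. indicator (cell k b) (x j)))
        \<in> borel_measurable (unif_points (insert i I))"
      by (intro borel_measurable_times_ennreal insert.prems borel_measurable_prod_ennreal
          measurable_PiM_unif_indicator) auto
  qed (simp add: prod_eq mult_ac del: fun_upd_apply, simp add: mult_ac)
  also have "\<dots> = (\<integral>\<^sup>+x. (p * H x) * (\<Prod>j\<in>I. indicator (cell k b) (x j)) \<partial>unif_points I)"
  proof (rule nn_integral_cong)
    fix x assume [measurable]: "x \<in> space (unif_points I)"
    have [measurable]: "(\<lambda>y. F (x(i := y))) \<in> borel_measurable unif"
      by measurable
    have "(\<integral>\<^sup>+y. (F (x(i := y)) * indicator (cell k b) y) * (\<Prod>j\<in>I. indicator (cell k b) (x j)) \<partial>unif)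
      = (\<integral>\<^sup>+y. F (x(i := y)) * indicator (cell k b) y \<partial>unif) * (\<Prod>j\<in>I. indicator (cell k b) (x j))"
      by (rule nn_integral_multc) simp
    also have "(\<integral>\<^sup>+y. F (x(i := y)) * indicator (cell k b) y \<partial>unif) = p * H x"
      unfolding p_def H_def \<phi>_def by (rule nn_integral_unif_cell[OF k sub]) measurable
    finally show "(\<integral>\<^sup>+y. (F (x(i := y)) * indicator (cell k b) y) * (\<Prod>j\<in>I. indicator (cell k b) (x j)) \<partial>unif)
      = (p * H x) * (\<Prod>j\<in>I. indicator (cell k b) (x j))" .
  qed
  also have "\<dots> = p ^ card I * (\<integral>\<^sup>+u. p * H (\<lambda>i\<in>I. \<phi> (u i)) \<partial>unif_points I)"
    unfolding p_def \<phi>_def by (rule insert.IH) measurable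
  also have "(\<integral>\<^sup>+u. p * H (\<lambda>i\<in>I. \<phi> (u i)) \<partial>unif_points I) = p * (\<integral>\<^sup>+u. H (\<lambda>i\<in>I. \<phi> (u i)) \<partial>unif_points I)"
    by (rule nn_integral_cmult) measurable
  also have "(\<integral>\<^sup>+u. H (\<lambda>i\<in>I. \<phi> (u i)) \<partial>unif_points I)
    = (\<integral>\<^sup>+u. \<integral>\<^sup>+y. F (\<lambda>j\<in>insert i I. \<phi> ((u(i := y)) j)) \<partial>unif \<partial>unif_points I)"
    unfolding H_def using insert.hyps
    by (intro nn_integral_cong arg_cong[where f = F]) (auto simp: fun_eq_iff)
  also have "\<dots> = (\<integral>\<^sup>+u. F (\<lambda>j\<in>insert i I. \<phi> (u j)) \<partial>unif_points (insert i I))"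
    by (subst product_sigma_finite.product_nn_integral_insert[OF product_sigma_finite_unif]) auto
  finally show ?case
    unfolding card_insert_disjoint[OF insert.hyps] power_Suc p_def \<phi>_def by (simp only: mult_ac)
qed

section \<open>The first points in a cell\<close>

text \<open>
  For \<open>card I = m\<close> this says that \<open>I\<close> consists of the \<open>m\<close> smallest labels in \<open>J\<close>.
\<close>

definition initial_part :: "'v::linorder set \<Rightarrow> 'v set \<Rightarrow> bool" where
  "initial_part J I \<longleftrightarrow> I \<subseteq> J \<and> (\<forall>j\<in>J - I. \<forall>i\<in>I. i < j)"

lemma initial_part_unique:
  assumes "initial_part J I" "initial_part J I'" "card I = card I'" "finite J"
  shows "I = I'"
proof -
  have fin: "finite I" "finite I'"
    using assms finite_subset[of _ J] by (auto simp: initial_part_def)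
  have "I \<subseteq> I' \<or> I' \<subseteq> I"
    using assms(1,2) unfolding initial_part_def by (meson DiffI less_asym subsetD subsetI)
  then show ?thesis
    using assms(3) fin card_subset_eq by metis
qed

lemma initial_part_exists:
  assumes "finite J" "m \<le> card J"
  shows "\<exists>I. initial_part J I \<and> card I = m"
  using assms(2)
proof (induction m)
  case 0
  then show ?case
    using assms by (auto simp: initial_part_def intro!: exI[of _ "{}"])
next
  case (Suc m)
  then obtain I where I: "initial_part J I" "card I = m"
    by auto
  have fin: "finite I"
    using I(1) assms(1) finite_subset[of I J] by (auto simp: initial_part_def)
  have "J - I \<noteq> {}"
    using Suc.prems I(2) fin by (metis Diff_eq_empty_iff Suc_n_not_le_n card_mono le_trans)
  define a where "a = Min (J - I)"
  have a: "a \<in> J - I" "\<And>j. j \<in> J - I \<Longrightarrow> a \<le> j"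
    using \<open>J - I \<noteq> {}\<close> assms(1) unfolding a_def by (auto intro: Min_in simp del: Diff_iff)
  have "initial_part J (insert a I)"
    unfolding initial_part_def
  proof (intro conjI ballI)
    fix j i assume "j \<in> J - insert a I" "i \<in> insert a I"
    then show "i < j"
      using a(2)[of j] I(1) unfolding initial_part_def by (cases "i = a") auto
  qed (use I a in \<open>auto simp: initial_part_def\<close>)
  moreover have "card (insert a I) = Suc m"
    using a fin I by simp
  ultimately show ?case by blast
qed

lemma sets_initial_part_cell:
  assumes V: "finite V" and I: "I \<subseteq> V" and Q: "Q \<in> sets borel"
  shows "{x \<in> space (unif_points V). initial_part {j \<in> V. x j \<in> Q} I} \<in> sets (unif_points V)"
proof -
  have comp: "Measurable.pred (unif_points V) (\<lambda>x. x j \<in> Q)" if "j \<in> V" for j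
    using measurable_sets[OF measurable_PiM_unif_component[OF that] Q]
    by (simp add: pred_def vimage_def Int_def conj_commute)
  have "initial_part {j \<in> V. x j \<in> Q} I \<longleftrightarrow>
      (\<forall>i\<in>I. x i \<in> Q) \<and> (\<forall>j\<in>V - I. x j \<in> Q \<longrightarrow> (\<forall>i\<in>I. i < j))" for x
    using I by (auto simp: initial_part_def)
  then show ?thesis
    unfolding pred_def[symmetric] using V I finite_subset[OF I V]
    by (auto intro!: pred_intros_logic pred_intros_finite comp)
qed

text \<open>
  That \<open>I\<close> is the set of the first labels in the cell means that the points of \<open>I\<close> lie in the cell
  and that certain points outside \<open>I\<close> do not. The second condition is independent of the points
  of \<open>I\<close>, so that conditionally on the event these are independent and uniform in the cell.
\<close>

lemma nn_integral_initial_part_cell: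
  fixes V :: "'v::linorder set"
  assumes k: "0 < k" and sub: "cell k b \<subseteq> box 0 1" and V: "finite V" and I: "I \<subseteq> V"
    and F: "F \<in> borel_measurable (unif_points I)"
  shows "(\<integral>\<^sup>+x. F (restrict x I) * indicator {x. initial_part {j \<in> V. x j \<in> cell k b} I} x
            \<partial>unif_points V)
    = (\<integral>\<^sup>+u. F (\<lambda>i\<in>I. cellmap k b (u i)) \<partial>unif_points I)
      * emeasure (unif_points V) {x \<in> space (unif_points V). initial_part {j \<in> V. x j \<in> cell k b} I}"
proof -
  define Q where "Q = cell k b"
  define J where "J = V - I"
  \<comment> \<open>the labels that would come before some label of \<open>I\<close>\<close>
  define bad where "bad = {j \<in> J. \<exists>i\<in>I. j < i}"
  have fin: "finite I" "finite J" "I \<inter> J = {}" "I \<union> J = V" "bad \<subseteq> J"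
    using V I finite_subset[OF I V] by (auto simp: J_def bad_def)
  have Q [measurable]: "Q \<in> sets borel"
    by (simp add: Q_def)
  define R where "R = (\<lambda>x. \<Prod>j\<in>bad. indicator (- Q) (x j) :: ennreal)"
  have ind: "indicator {x. initial_part {j \<in> V. x j \<in> Q} I} x = (\<Prod>i\<in>I. indicator Q (x i)) * R x" for x
  proof -
    have "finite bad"
      using fin finite_subset by blast
    then have "(\<Prod>i\<in>I. indicator Q (x i)) * R x = (if (\<forall>i\<in>I. x i \<in> Q) \<and> (\<forall>j\<in>bad. x j \<notin> Q) then 1 else 0)"
      using fin(1) unfolding R_def by (auto simp: indicator_def intro!: prod.neutral)
    moreover have "initial_part {j \<in> V. x j \<in> Q} I \<longleftrightarrow> (\<forall>i\<in>I. x i \<in> Q) \<and> (\<forall>j\<in>bad. x j \<notin> Q)"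
    proof
      assume f: "initial_part {j \<in> V. x j \<in> Q} I"
      have "x j \<notin> Q" if "j \<in> bad" for j
      proof
        assume "x j \<in> Q"
        with that f have "\<forall>i\<in>I. i < j"
          by (auto simp: initial_part_def bad_def J_def)
        then show False
          using that by (auto simp: bad_def dest: less_asym)
      qed
      then show "(\<forall>i\<in>I. x i \<in> Q) \<and> (\<forall>j\<in>bad. x j \<notin> Q)"
        using f by (auto simp: initial_part_def)
    next
      assume r: "(\<forall>i\<in>I. x i \<in> Q) \<and> (\<forall>j\<in>bad. x j \<notin> Q)"
      show "initial_part {j \<in> V. x j \<in> Q} I"
        unfolding initial_part_def
      proof (intro conjI ballI)
        fix j i assume j: "j \<in> {j \<in> V. x j \<in> Q} - I" and i: "i \<in> I"
        then have "\<not> j < i" "i \<noteq> j"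
          using r by (auto simp: bad_def J_def)
        then show "i < j" by auto
      qed (use r I in auto)
    qed
    ultimately show ?thesis
      by (simp add: indicator_def)
  qed
  have Rm: "R \<in> borel_measurable (unif_points K)" if "bad \<subseteq> K" for K
    unfolding R_def using that
    by (intro borel_measurable_prod_ennreal measurable_PiM_unif_indicator) auto
  have main: "(\<integral>\<^sup>+x. G (restrict x I) * indicator {x. initial_part {j \<in> V. x j \<in> Q} I} x \<partial>unif_points V)
    = (ennreal (1 / (real k)\<^sup>2) ^ card I * (\<integral>\<^sup>+u. G (\<lambda>i\<in>I. cellmap k b (u i)) \<partial>unif_points I))
      * (\<integral>\<^sup>+y. R y \<partial>unif_points J)"
    if G: "G \<in> borel_measurable (unif_points I)" for G
  proof -
    have G': "(\<lambda>x. G (restrict x I)) \<in> borel_measurable (unif_points V)"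
      by (rule measurable_compose[OF measurable_restrict_subset[OF I] G])
    have meas: "(\<lambda>x. G (restrict x I) * ((\<Prod>i\<in>I. indicator Q (x i)) * R x)) \<in> borel_measurable (unif_points (I \<union> J))"
      unfolding fin(4) using I fin
      by (intro borel_measurable_times_ennreal G' borel_measurable_prod_ennreal
          measurable_PiM_unif_indicator Rm) auto
    have fold: "(\<integral>\<^sup>+x. G (restrict x I) * ((\<Prod>i\<in>I. indicator Q (x i)) * R x) \<partial>unif_points V)
      = (\<integral>\<^sup>+x. \<integral>\<^sup>+y. G (restrict (merge I J (x, y)) I)
            * ((\<Prod>i\<in>I. indicator Q (merge I J (x, y) i)) * R (merge I J (x, y)))
          \<partial>unif_points J \<partial>unif_points I)"
      using product_sigma_finite.product_nn_integral_fold[OF product_sigma_finite_unif fin(3,1,2) meas]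
      by (simp only: fin(4))
    have "(\<integral>\<^sup>+x. G (restrict x I) * ((\<Prod>i\<in>I. indicator Q (x i)) * R x) \<partial>unif_points V)
      = (\<integral>\<^sup>+x. \<integral>\<^sup>+y. (G x * (\<Prod>i\<in>I. indicator Q (x i))) * R y \<partial>unif_points J \<partial>unif_points I)"
      unfolding fold
    proof (rule nn_integral_cong, rule nn_integral_cong)
      fix x y assume x: "x \<in> space (unif_points I)" and y: "y \<in> space (unif_points J)"
      have "restrict (merge I J (x, y)) I = restrict x I"
        using fin(3) by (rule restrict_merge)
      also have "\<dots> = x"
        using x by (simp add: space_PiM)
      finally have "restrict (merge I J (x, y)) I = x" .
      moreover have "(\<Prod>i\<in>I. indicator Q (merge I J (x, y) i)) = (\<Prod>i\<in>I. indicator Q (x i) :: ennreal)"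
        by (intro prod.cong) (auto simp: merge_def)
      moreover have "R (merge I J (x, y)) = R y"
        unfolding R_def by (intro prod.cong) (use fin in \<open>auto simp: merge_def\<close>)
      ultimately show "G (restrict (merge I J (x, y)) I) * ((\<Prod>i\<in>I. indicator Q (merge I J (x, y) i)) * R (merge I J (x, y)))
        = (G x * (\<Prod>i\<in>I. indicator Q (x i))) * R y"
        by (simp add: mult.assoc)
    qed
    also have "\<dots> = (\<integral>\<^sup>+x. (G x * (\<Prod>i\<in>I. indicator Q (x i))) * (\<integral>\<^sup>+y. R y \<partial>unif_points J) \<partial>unif_points I)"
      by (intro nn_integral_cong nn_integral_cmult Rm fin)
    also have "\<dots> = (\<integral>\<^sup>+x. G x * (\<Prod>i\<in>I. indicator Q (x i)) \<partial>unif_points I) * (\<integral>\<^sup>+y. R y \<partial>unif_points J)"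
      by (intro nn_integral_multc borel_measurable_times_ennreal G borel_measurable_prod_ennreal
          measurable_PiM_unif_indicator) auto
    also have "(\<integral>\<^sup>+x. G x * (\<Prod>i\<in>I. indicator Q (x i)) \<partial>unif_points I)
        = ennreal (1 / (real k)\<^sup>2) ^ card I * (\<integral>\<^sup>+u. G (\<lambda>i\<in>I. cellmap k b (u i)) \<partial>unif_points I)"
      unfolding Q_def by (rule nn_integral_PiM_unif_cell[OF k sub fin(1) G])
    finally show ?thesis
      by (simp only: ind)
  qed
  have "emeasure (unif_points V) {x \<in> space (unif_points V). initial_part {j \<in> V. x j \<in> Q} I}
    = (\<integral>\<^sup>+x. indicator {x \<in> space (unif_points V). initial_part {j \<in> V. x j \<in> Q} I} x \<partial>unif_points V)"
    by (rule nn_integral_indicator[symmetric]) (rule sets_initial_part_cell[OF V I Q])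
  also have "\<dots> = (\<integral>\<^sup>+x. 1 * indicator {x. initial_part {j \<in> V. x j \<in> Q} I} x \<partial>unif_points V)"
    by (intro nn_integral_cong) (auto simp: indicator_def)
  also have "\<dots> = ennreal (1 / (real k)\<^sup>2) ^ card I * (\<integral>\<^sup>+y. R y \<partial>unif_points J)"
    using main[of "\<lambda>_. 1"] by (simp add: emeasure_PiM_unif_space)
  finally show ?thesis
    using main[OF F] unfolding Q_def by (simp add: mult_ac)
qed

section \<open>Relabelling and rescaling the nodes\<close>

lemma mst_weight_relabel_le:
  assumes V: "finite V" "V \<noteq> {}" and inj: "inj_on s V" and w: "\<And>e. 0 \<le> w e"
  shows "mst_weight (s ` V) w \<le> mst_weight V (\<lambda>e. w (s ` e))"
proof -
  obtain T where T: "T \<in> spanning_trees V" "mst_weight V (\<lambda>e. w (s ` e)) = (\<Sum>e\<in>T. w (s ` e))"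
    using mst_weight_attained[OF V] .
  have finT: "finite T"
    using T(1) finite_complete_edges[OF V(1)] finite_subset by (auto simp: spanning_trees_def)
  define E where "E = (`) s ` T"
  have EV: "E \<subseteq> complete_edges (s ` V)"
  proof
    fix e assume "e \<in> E"
    then obtain d where d: "d \<in> T" "e = s ` d"
      by (auto simp: E_def)
    then have "d \<subseteq> V" "card d = 2"
      using spanning_tree_edgeD[OF T(1)] by (auto simp: complete_edges_def)
    then show "e \<in> complete_edges (s ` V)"
      using inj d(2) card_image[OF inj_on_subset[OF inj]] by (auto simp: complete_edges_def)
  qed
  have step: "(s x, s y) \<in> (adj E)\<^sup>*" if "(x, y) \<in> (adj T)\<^sup>*" for x y
    using that
  proof induction
    case (step y z)
    then have "{s y, s z} \<in> E"
      by (auto simp: E_def adj_iff intro!: image_eqI[of _ _ "{y, z}"])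
    with step.IH show ?case
      by (meson adj_iff rtrancl.rtrancl_into_rtrancl)
  qed auto
  have "connected_graph (s ` V) E"
    using T(1) step unfolding connected_graph_adj spanning_trees_def by blast
  then have "mst_weight (s ` V) w \<le> (\<Sum>e\<in>E. w e)"
    using V EV w by (intro mst_weight_le_connected) auto
  also have "\<dots> \<le> (\<Sum>e\<in>T. w (s ` e))"
    unfolding E_def using sum_image_le[OF finT, of w "(`) s"] w by (simp add: o_def)
  finally show ?thesis
    using T(2) by simp
qed

lemma edge_weight_doubleton:
  "i < j \<Longrightarrow> edge_weight \<alpha> h x {i, j} = h (x i) (x j) powr \<alpha>"
  by (simp add: edge_weight_def min_def max_def)

lemma complete_edgesE:
  fixes V :: "'v::linorder set"
  assumes "e \<in> complete_edges V"
  obtains i j where "i \<in> V" "j \<in> V" "i < j" "e = {i, j}"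
proof -
  from assms obtain i j where "e = {i, j}" "i \<noteq> j" "e \<subseteq> V"
    by (auto simp: complete_edges_def card_2_iff)
  then show ?thesis
    using that[of i j] that[of j i] by (cases "i < j") (auto simp: insert_commute)
qed

lemma edge_weight_relabel:
  assumes "strict_mono_on V s" "e \<in> complete_edges V"
  shows "edge_weight \<alpha> h x (s ` e) = edge_weight \<alpha> h (\<lambda>i\<in>V. x (s i)) e"
proof -
  obtain i j where ij: "i \<in> V" "j \<in> V" "i < j" "e = {i, j}"
    using assms(2) by (rule complete_edgesE)
  then have "s i < s j"
    using assms(1) by (simp add: strict_mono_onD)
  with ij show ?thesis
    by (simp add: edge_weight_doubleton)
qed

lemma edge_weight_nonneg: "0 \<le> edge_weight \<alpha> h x e"
  by (simp add: edge_weight_def)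

abbreviation mst_on :: "real \<Rightarrow> (real ^ 2 \<Rightarrow> real ^ 2 \<Rightarrow> real) \<Rightarrow> nat set \<Rightarrow> (nat \<Rightarrow> real ^ 2) \<Rightarrow> real" where
  "mst_on \<alpha> h I x \<equiv> mst_weight I (edge_weight \<alpha> h x)"

lemma mst_on_restrict: "mst_on \<alpha> h I (restrict x I) = mst_on \<alpha> h I x"
proof (rule mst_weight_cong)
  fix e assume "e \<in> complete_edges I"
  then obtain i j where "i \<in> I" "j \<in> I" "i < j" "e = {i, j}"
    by (rule complete_edgesE)
  then show "edge_weight \<alpha> h (restrict x I) e = edge_weight \<alpha> h x e"
    by (simp add: edge_weight_doubleton)
qed

lemma measurable_mst_on:
  assumes h: "(\<lambda>(u, v). h u v) \<in> borel_measurable (borel \<Otimes>\<^sub>M borel)"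
    and I: "finite I" and comp: "\<And>i. i \<in> I \<Longrightarrow> (\<lambda>x. X x i) \<in> N \<rightarrow>\<^sub>M borel"
  shows "(\<lambda>x. mst_on \<alpha> h I (X x)) \<in> borel_measurable N"
proof -
  have edge: "(\<lambda>x. edge_weight \<alpha> h (X x) e) \<in> borel_measurable N" if e: "e \<in> complete_edges I" for e
  proof -
    obtain i j where ij: "i \<in> I" "j \<in> I" "i < j" "e = {i, j}"
      using e by (rule complete_edgesE)
    have "(\<lambda>x. (X x i, X x j)) \<in> N \<rightarrow>\<^sub>M borel \<Otimes>\<^sub>M borel"
      by (intro measurable_Pair comp ij)
    from measurable_compose[OF this h] have [measurable]: "(\<lambda>x. h (X x i) (X x j)) \<in> borel_measurable N"
      by simp
    show ?thesis
      unfolding ij(4) edge_weight_doubleton[OF ij(3)] by measurable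
  qed
  show ?thesis
    unfolding mst_weight_def
    by (intro borel_measurable_Min finite_spanning_trees I borel_measurable_sum edge spanning_tree_edgeD)
qed

text \<open>
  The relabelling has to preserve the order of the labels, because \<open>edge_weight\<close> takes the endpoints
  of an edge in that order.
\<close>

lemma nn_integral_mst_on_relabel_le:
  assumes h: "(\<lambda>(u, v). h u v) \<in> borel_measurable (borel \<Otimes>\<^sub>M borel)"
    and I: "finite I" "card I = m" "0 < m"
  shows "(\<integral>\<^sup>+x. ennreal (mst_on \<alpha> h I x) \<partial>unif_points I)
    \<le> (\<integral>\<^sup>+x. ennreal (MST \<alpha> h x m) \<partial>unif_points {1..m})"
proof -
  define V where "V = {1..m}"
  define s where "s = (\<lambda>i. sorted_list_of_set I ! (i - 1))"
  have len: "length (sorted_list_of_set I) = m"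
    using I by simp
  have mono: "strict_mono_on V s"
    using I strict_sorted_list_of_set[of I] len
    by (auto simp: strict_mono_on_def s_def V_def sorted_wrt_iff_nth_less)
  have img: "s ` V = I"
  proof -
    have "s ` V = (!) (sorted_list_of_set I) ` {..<m}"
      unfolding s_def V_def by (force simp: image_iff intro: bexI[of _ "Suc _"])
    also have "\<dots> = I"
      using I len nth_image[of m "sorted_list_of_set I"] by (simp add: lessThan_atLeast0)
    finally show ?thesis .
  qed
  have inj: "inj_on s V"
    using mono by (rule strict_mono_on_imp_inj_on)
  have V: "finite V" "V \<noteq> {}"
    using I by (auto simp: V_def)
  have le: "mst_on \<alpha> h I x \<le> mst_on \<alpha> h V (\<lambda>i\<in>V. x (s i))" for x
  proof -
    have "mst_on \<alpha> h (s ` V) x \<le> mst_weight V (\<lambda>e. edge_weight \<alpha> h x (s ` e))"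
      by (intro mst_weight_relabel_le V inj edge_weight_nonneg)
    also have "\<dots> = mst_on \<alpha> h V (\<lambda>i\<in>V. x (s i))"
      by (intro mst_weight_cong edge_weight_relabel[OF mono])
    finally show ?thesis
      by (simp add: img)
  qed
  have sm: "(\<lambda>x. \<lambda>i\<in>V. x (s i)) \<in> unif_points I \<rightarrow>\<^sub>M unif_points V"
    using img by (intro measurable_restrict measurable_component_singleton) auto
  have mm: "(\<lambda>x. ennreal (mst_on \<alpha> h V x)) \<in> borel_measurable (unif_points V)"
    by (intro measurable_compose[OF measurable_mst_on measurable_ennreal]
        h V measurable_PiM_unif_component)
  have "(\<integral>\<^sup>+x. ennreal (mst_on \<alpha> h I x) \<partial>unif_points I)
      \<le> (\<integral>\<^sup>+x. ennreal (mst_on \<alpha> h V (\<lambda>i\<in>V. x (s i))) \<partial>unif_points I)"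
    by (intro nn_integral_mono ennreal_leI le)
  also have "\<dots> = (\<integral>\<^sup>+x. ennreal (mst_on \<alpha> h V x) \<partial>distr (unif_points I) (unif_points V) (\<lambda>x. \<lambda>i\<in>V. x (s i)))"
    by (rule nn_integral_distr[OF sm, symmetric]) (use mm in simp)
  also have "distr (unif_points I) (unif_points V) (\<lambda>x. \<lambda>i\<in>V. x (s i)) = unif_points V"
    using img by (intro distr_PiM_reindex prob_space_unif inj) auto
  finally show ?thesis
    by (simp add: MST_def V_def)
qed

text \<open>
  Here (b2) removes the translation at the price of \<open>h0\<close>, and (b1) accounts for the dilation.
\<close>

lemma mst_on_cellmap_le:
  assumes b1: "\<And>a u v. a > 0 \<Longrightarrow> h (a *\<^sub>R u) (a *\<^sub>R v) = a * h u v"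
    and b2: "\<And>b u v. h (b + u) (b + v) \<le> h0 * h u v"
    and nonneg: "\<And>u v. h u v \<ge> (0::real)"
    and pos: "0 < k" "0 < \<alpha>" "0 < h0" and I: "finite I" "I \<noteq> {}"
  shows "mst_on \<alpha> h I (\<lambda>i\<in>I. cellmap k b (u i)) \<le> (h0 powr \<alpha> * real k powr (- \<alpha>)) * mst_on \<alpha> h I u"
proof (rule mst_weight_le_scaled[OF I])
  fix e assume "e \<in> complete_edges I"
  then obtain i j where ij: "i \<in> I" "j \<in> I" "i < j" "e = {i, j}"
    by (rule complete_edgesE)
  have "h (cellmap k b (u i)) (cellmap k b (u j)) \<le> (h0 / k) * h (u i) (u j)"
    using b2[of b "u i" "u j"] pos(1) unfolding cellmap_def
    by (subst b1) (auto simp: field_simps)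
  then have "h (cellmap k b (u i)) (cellmap k b (u j)) powr \<alpha> \<le> ((h0 / k) * h (u i) (u j)) powr \<alpha>"
    using pos nonneg by (intro powr_mono2) auto
  also have "\<dots> = (h0 powr \<alpha> * real k powr (- \<alpha>)) * h (u i) (u j) powr \<alpha>"
    using pos nonneg by (simp add: powr_mult powr_divide powr_minus field_simps)
  finally show "edge_weight \<alpha> h (\<lambda>i\<in>I. cellmap k b (u i)) e
      \<le> (h0 powr \<alpha> * real k powr (- \<alpha>)) * edge_weight \<alpha> h u e"
    using ij by (simp add: edge_weight_doubleton)
qed

section \<open>Edges to lower neighbours\<close>

text \<open>
  On the open square the coordinates are positive, so this is the sup norm. It serves as the order
  \<open>\<rho>\<close> along which points are attached.
\<close>

definition supnorm :: "real ^ 2 \<Rightarrow> real" where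
  "supnorm p = max (p $ 1) (p $ 2)"

text \<open>
  A square of side \<open>t\<close> at \<open>p\<close>, pushed back into the positive quadrant. As long as \<open>t\<close> is
  below the sup norm of \<open>p\<close>, all its points are lower than \<open>p\<close>. Thus the square has its full
  area \<open>t^2\<close> inside the unit square, even for \<open>p\<close> near the boundary.
\<close>

definition nearbox :: "real ^ 2 \<Rightarrow> real \<Rightarrow> (real ^ 2) set" where
  "nearbox p t = {q. \<forall>c. max 0 (p $ c - t) < q $ c \<and> q $ c < max 0 (p $ c - t) + t}"

lemma nearbox_eq_box:
  "nearbox p t = box (\<chi> c. max 0 (p $ c - t)) ((\<chi> c. max 0 (p $ c - t)) + t *\<^sub>R 1)"
  by (auto simp: nearbox_def mem_box_cart)

lemma in_unit_boxD: "p \<in> box 0 (1 :: real ^ 'n) \<Longrightarrow> 0 < p $ c \<and> p $ c < 1"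
  by (simp add: mem_box_cart)

lemma supnorm_bounds:
  assumes "p \<in> box 0 1"
  shows "0 < supnorm p" "supnorm p < 1" "p $ c \<le> supnorm p"
  using in_unit_boxD[OF assms, of 1] in_unit_boxD[OF assms, of 2] exhaust_2[of c]
  by (auto simp: supnorm_def)

lemma dist_le_double:
  fixes p q :: "real ^ 2"
  assumes "\<And>c. \<bar>p $ c - q $ c\<bar> \<le> t"
  shows "dist p q \<le> 2 * t"
proof -
  have "dist p q \<le> \<bar>p $ 1 - q $ 1\<bar> + \<bar>p $ 2 - q $ 2\<bar>"
    using norm_le_l1_cart[of "p - q"] by (simp add: dist_norm sum_2)
  also have "\<dots> \<le> 2 * t"
    using assms[of 1] assms[of 2] by simp
  finally show ?thesis .
qed

lemma nearbox:
  assumes p: "p \<in> box 0 1" and t: "0 \<le> t" "t < supnorm p"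
  shows "nearbox p t \<subseteq> box 0 1"
    and "q \<in> nearbox p t \<Longrightarrow> supnorm q < supnorm p"
    and "q \<in> nearbox p t \<Longrightarrow> dist p q \<le> 2 * t"
proof -
  have *: "0 < q $ c" "q $ c < supnorm p" "\<bar>p $ c - q $ c\<bar> \<le> t"
    if "q \<in> nearbox p t" for q c
  proof -
    have q: "max 0 (p $ c - t) < q $ c" "q $ c < max 0 (p $ c - t) + t"
      using that by (auto simp: nearbox_def)
    then show "0 < q $ c" "q $ c < supnorm p" "\<bar>p $ c - q $ c\<bar> \<le> t"
      using supnorm_bounds(3)[OF p, of c] in_unit_boxD[OF p, of c] t by auto
  qed
  show "nearbox p t \<subseteq> box 0 1"
    using *(1) less_trans[OF *(2) supnorm_bounds(2)[OF p]] by (auto simp: mem_box_cart)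
  show "supnorm q < supnorm p" if "q \<in> nearbox p t"
    using *(2)[OF that] by (auto simp: supnorm_def[of q])
  show "dist p q \<le> 2 * t" if "q \<in> nearbox p t"
    using *(3)[OF that] by (rule dist_le_double)
qed

definition lonely :: "'v set \<Rightarrow> 'v \<Rightarrow> real \<Rightarrow> ('v \<Rightarrow> real ^ 2) \<Rightarrow> bool" where
  "lonely V i t x \<longleftrightarrow> t < supnorm (x i) \<and> (\<forall>j\<in>V - {i}. x j \<notin> nearbox (x i) t)"

text \<open>
  At the first multiple \<open>t\<close> of \<open>\<delta>\<close> at which \<open>i\<close> is no longer lonely, either the near box of
  \<open>x i\<close> contains a point, or \<open>t\<close> has reached the sup norm of \<open>x i\<close>. In the latter case every lower
  point is within \<open>t\<close> in each coordinate, and there is one since \<open>i\<close> is not the root. One step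
  earlier \<open>i\<close> was lonely, which is what makes a long edge unlikely.
\<close>

lemma lower_neighbour_exists:
  fixes V :: "'v::linorder set"
  assumes V: "finite V" "i \<in> V" and x: "\<And>j. j \<in> V \<Longrightarrow> x j \<in> box 0 1"
    and not_root: "i \<noteq> lowest (\<lambda>j. supnorm (x j)) V" and \<delta>: "0 < \<delta>"
  obtains j l where "j \<in> V" "lower (\<lambda>j. supnorm (x j)) j i" "real l * \<delta> < 1"
    "lonely V i (real l * \<delta>) x" "dist (x i) (x j) \<le> 2 * (real (Suc l) * \<delta>)"
proof -
  define P where "P = (\<lambda>l::nat. \<not> lonely V i (real l * \<delta>) x)"
  obtain L0 :: nat where "1 < real L0 * \<delta>"
    using reals_Archimedean3[OF \<delta>] by blast
  then have "P L0"
    using supnorm_bounds(2)[OF x[OF V(2)]] by (auto simp: P_def lonely_def)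
  have "\<not> P 0"
    using supnorm_bounds(1)[OF x[OF V(2)]] by (auto simp: P_def lonely_def nearbox_def)
  define L where "L = (LEAST l. P l)"
  have "P L"
    unfolding L_def using \<open>P L0\<close> by (rule LeastI)
  with \<open>\<not> P 0\<close> obtain l where l: "L = Suc l"
    by (cases L) auto
  have "\<not> P l"
    using not_less_Least[of l P] l by (simp add: L_def)
  then have lon: "lonely V i (real l * \<delta>) x"
    by (simp add: P_def)
  have "real l * \<delta> < 1"
    using lon supnorm_bounds(2)[OF x[OF V(2)]] by (simp add: lonely_def)
  have "\<exists>j\<in>V. lower (\<lambda>j. supnorm (x j)) j i \<and> dist (x i) (x j) \<le> 2 * (real (Suc l) * \<delta>)"
  proof (cases "real (Suc l) * \<delta> < supnorm (x i)")
    case True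
    then obtain j where j: "j \<in> V" "x j \<in> nearbox (x i) (real (Suc l) * \<delta>)"
      using \<open>P L\<close> by (auto simp: P_def lonely_def l)
    have "0 \<le> real (Suc l) * \<delta>"
      using \<delta> by simp
    note nb = nearbox[OF x[OF V(2)] this True]
    show ?thesis
      using j nb(2,3)[OF j(2)] by (auto simp: lower_def)
  next
    case False
    define r where "r = lowest (\<lambda>j. supnorm (x j)) V"
    have r: "r \<in> V" "lower (\<lambda>j. supnorm (x j)) r i"
      using lowest[OF V(1), where \<rho> = "\<lambda>j. supnorm (x j)"] V(2) not_root
      unfolding r_def by blast+
    have "\<bar>x i $ c - x r $ c\<bar> \<le> real (Suc l) * \<delta>" for c
    proof -
      have "supnorm (x r) \<le> supnorm (x i)"
        using r(2) by (auto simp: lower_def)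
      then have "0 < x r $ c" "x r $ c \<le> supnorm (x i)" "0 < x i $ c" "x i $ c \<le> supnorm (x i)"
        using supnorm_bounds(3)[OF x[OF r(1)], of c] supnorm_bounds(3)[OF x[OF V(2)], of c]
          in_unit_boxD[OF x[OF r(1)], of c] in_unit_boxD[OF x[OF V(2)], of c] by auto
      then show ?thesis
        using False by auto
    qed
    then show ?thesis
      using r dist_le_double by blast
  qed
  then show ?thesis
    using that \<open>real l * \<delta> < 1\<close> lon by blast
qed

lemma measurable_PiM_unif_coord:
  "i \<in> I \<Longrightarrow> (\<lambda>x. x i $ c) \<in> borel_measurable (unif_points I)"
  by (rule measurable_compose[OF measurable_PiM_unif_component borel_measurable_nth])

lemma pred_lonely:
  assumes "finite V" "i \<in> V"
  shows "Measurable.pred (unif_points V) (lonely V i t)"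
proof -
  have near: "Measurable.pred (unif_points V) (\<lambda>x. x j \<notin> nearbox (x i) t)" if j: "j \<in> V" for j
    unfolding nearbox_def mem_Collect_eq forall_2
    by (intro pred_intros_logic borel_measurable_pred_less borel_measurable_max
        borel_measurable_add borel_measurable_diff borel_measurable_const
        measurable_PiM_unif_coord assms(2) j)
  have "Measurable.pred (unif_points V) (\<lambda>x. t < supnorm (x i))"
    unfolding supnorm_def
    by (intro borel_measurable_pred_less borel_measurable_max borel_measurable_const
        measurable_PiM_unif_coord assms(2))
  then show ?thesis
    unfolding lonely_def[abs_def] using assms(1)
    by (auto intro!: pred_intros_logic(3) pred_intros_finite near)
qed

text \<open>
  Given a position of the point \<open>i\<close> with sup norm above \<open>t\<close>, the other points avoid its near box
  independently, each with probability \<open>1 - t^2\<close>.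
\<close>

lemma emeasure_lonely_le:
  assumes V: "finite V" "i \<in> V" and t: "0 \<le> t"
  shows "emeasure (unif_points V) {x \<in> space (unif_points V). lonely V i t x}
    \<le> ennreal (exp (- (t\<^sup>2 * real (card V - 1))))"
proof -
  define J where "J = V - {i}"
  have J: "finite J" "i \<notin> J" "insert i J = V" "card J = card V - 1"
    using V by (auto simp: J_def)
  define A where "A = {x \<in> space (unif_points V). lonely V i t x}"
  have A: "A \<in> sets (unif_points V)"
    unfolding A_def using pred_lonely[OF V, of t] by (simp add: pred_def)
  have "emeasure (unif_points V) A = (\<integral>\<^sup>+x. indicator A x \<partial>unif_points V)"
    using A by simp
  also have "\<dots> = (\<integral>\<^sup>+y. (\<integral>\<^sup>+x. indicator A (x(i := y)) \<partial>unif_points J) \<partial>unif)"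
    using product_sigma_finite.product_nn_integral_insert_rev[OF product_sigma_finite_unif J(1,2), of "indicator A"]
      A J(3) by simp
  also have "\<dots> \<le> (\<integral>\<^sup>+y. ennreal (exp (- (t\<^sup>2 * real (card V - 1)))) \<partial>unif)"
  proof (rule nn_integral_mono)
    fix y assume "y \<in> space unif"
    then have y: "y \<in> box 0 1"
      by (simp add: space_unif)
    show "(\<integral>\<^sup>+x. indicator A (x(i := y)) \<partial>unif_points J) \<le> ennreal (exp (- (t\<^sup>2 * real (card V - 1))))"
    proof (cases "t < supnorm y")
      case False
      then have "indicator A (x(i := y)) = (0 :: ennreal)" for x
        by (auto simp: A_def lonely_def)
      then show ?thesis
        by simp
    next
      case True
      have t1: "t \<le> 1"
        using True supnorm_bounds(2)[OF y] by simp
      have box: "nearbox y t \<in> sets borel" "nearbox y t \<in> sets unif"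
          "emeasure unif (nearbox y t) = ennreal (t\<^sup>2)"
        using sets_unif[OF _ nearbox(1)[OF y t True]] emeasure_unif[OF _ nearbox(1)[OF y t True]]
          emeasure_lborel_square(1)[OF t]
        by (simp_all add: nearbox_eq_box)
      have "(\<integral>\<^sup>+z. indicator (- nearbox y t) z \<partial>unif)
          = (\<integral>\<^sup>+z. indicator (space unif - nearbox y t) z \<partial>unif)"
        by (intro nn_integral_cong) (simp add: indicator_def)
      also have "\<dots> = emeasure unif (space unif - nearbox y t)"
        using box(2) by simp
      also have "\<dots> = emeasure unif (space unif) - emeasure unif (nearbox y t)"
        using box by (intro emeasure_compl) auto
      also have "\<dots> = ennreal (1 - t\<^sup>2)"
        using box(3) t t1 by (simp add: prob_space.emeasure_space_1[OF prob_space_unif] ennreal_minus[symmetric])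
      finally have one: "(\<integral>\<^sup>+z. indicator (- nearbox y t) z \<partial>unif) = ennreal (1 - t\<^sup>2)" .
      have "(\<integral>\<^sup>+x. indicator A (x(i := y)) \<partial>unif_points J)
        \<le> (\<integral>\<^sup>+x. (\<Prod>j\<in>J. indicator (- nearbox y t) (x j)) \<partial>unif_points J)"
      proof (rule nn_integral_mono)
        fix x
        have "(\<Prod>j\<in>J. indicator (- nearbox y t) (x j)) = (1 :: ennreal)" if "x(i := y) \<in> A"
          using that J(2) by (intro prod.neutral) (auto simp: A_def lonely_def J_def split: if_splits)
        then show "indicator A (x(i := y)) \<le> (\<Prod>j\<in>J. indicator (- nearbox y t) (x j) :: ennreal)"
          by (auto simp: indicator_def)
      qed
      also have "\<dots> = (\<Prod>j\<in>J. \<integral>\<^sup>+z. indicator (- nearbox y t) z \<partial>unif)"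
        using box(2) J(1)
        by (intro product_sigma_finite.product_nn_integral_prod[OF product_sigma_finite_unif])
          (auto simp: borel_measurable_indicator_iff Diff_eq[symmetric] Int_commute)
      also have "\<dots> = ennreal ((1 - t\<^sup>2) ^ (card V - 1))"
        using t t1 J(4) by (simp add: one ennreal_power power_le_one)
      also have "\<dots> \<le> ennreal (exp (- (t\<^sup>2 * real (card V - 1))))"
      proof (rule ennreal_leI)
        have "(1 - t\<^sup>2) ^ (card V - 1) \<le> exp (- t\<^sup>2) ^ (card V - 1)"
          using t t1 exp_ge_add_one_self[of "- t\<^sup>2"] by (intro power_mono) (auto simp: power_le_one)
        also have "\<dots> = exp (- (t\<^sup>2 * real (card V - 1)))"
          by (simp add: exp_of_nat_mult[symmetric] mult.commute)
        finally show "(1 - t\<^sup>2) ^ (card V - 1) \<le> exp (- (t\<^sup>2 * real (card V - 1)))" .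
      qed
      finally show ?thesis .
    qed
  qed
  also have "\<dots> = ennreal (exp (- (t\<^sup>2 * real (card V - 1))))"
    by (simp add: prob_space.emeasure_space_1[OF prob_space_unif])
  finally show ?thesis
    by (simp add: A_def)
qed

text \<open>
  An upper bound for the square of the weight of the edge from \<open>i\<close> to a lower neighbour, in units of
  \<open>n powr (- \<alpha> / 2)\<close> where \<open>n = card V\<close>. The summand \<open>l\<close> pays for an edge whose length is about
  \<open>l\<close> units of \<open>n powr (- 1 / 2)\<close>.
\<close>

definition nbcost :: "real \<Rightarrow> real \<Rightarrow> 'v set \<Rightarrow> 'v \<Rightarrow> ('v \<Rightarrow> real ^ 2) \<Rightarrow> real" where
  "nbcost \<alpha> c V i x = (\<Sum>l\<le>card V. (2 * c * real (Suc l)) powr (2 * \<alpha>)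
      * indicator {x. lonely V i (real l / sqrt (real (card V))) x} x)"

lemma nbcost_nonneg: "0 \<le> nbcost \<alpha> c V i x"
  by (auto simp: nbcost_def intro!: sum_nonneg)

text \<open>
  The bound is linear in \<open>1 / \<epsilon>\<close> and \<open>\<epsilon>\<close> in order to decouple the cost of an edge from the question
  whether the edge is needed: summed over a random set of \<open>j\<close> points it is at most the fixed
  quantity \<open>\<epsilon> * (\<Sum>i\<in>V. nbcost \<alpha> c V i x)\<close> plus \<open>j / \<epsilon>\<close>, up to the common factor.
\<close>

lemma cheap_lower_neighbour:
  fixes V :: "nat set"
  assumes V: "finite V" "i \<in> V" and x: "\<And>j. j \<in> V \<Longrightarrow> x j \<in> box 0 1"
    and not_root: "i \<noteq> lowest (\<lambda>j. supnorm (x j)) V" and pos: "0 < \<alpha>" "0 < c" "0 < \<epsilon>"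
    and h: "\<And>u v. 0 \<le> h u v" "\<And>u v. u \<in> unit_square \<Longrightarrow> v \<in> unit_square \<Longrightarrow> h u v \<le> c * dist u v"
  obtains j where "j \<in> V" "lower (\<lambda>j. supnorm (x j)) j i"
    "edge_weight \<alpha> h x {i, j} \<le> real (card V) powr (- \<alpha> / 2) * (\<epsilon> * nbcost \<alpha> c V i x + 1 / \<epsilon>)"
proof -
  define n where "n = real (card V)"
  have n: "1 \<le> n"
    using V by (simp add: n_def Suc_le_eq card_gt_0_iff) blast
  define \<delta> where "\<delta> = 1 / sqrt n"
  have \<delta>: "0 < \<delta>"
    using n by (simp add: \<delta>_def)
  obtain j l where jl: "j \<in> V" "lower (\<lambda>j. supnorm (x j)) j i" "real l * \<delta> < 1"
    "lonely V i (real l * \<delta>) x" "dist (x i) (x j) \<le> 2 * (real (Suc l) * \<delta>)"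
    using lower_neighbour_exists[OF V x not_root \<delta>] .
  have "j \<noteq> i"
    using jl(2) lower_irrefl by metis
  define y where "y = (2 * c * real (Suc l)) powr \<alpha>"
  have y0: "0 \<le> y"
    by (simp add: y_def)
  have sq: "p \<in> unit_square" if "p \<in> box 0 1" for p
    using that box_subset_cbox[of 0 "1 :: real ^ 2"] by (auto simp: unit_square_def)
  have "h (x a) (x b) \<le> 2 * c * real (Suc l) * \<delta>" if "{a, b} = {i, j}" for a b
  proof -
    have "dist (x a) (x b) = dist (x i) (x j)"
      using that by (auto simp: doubleton_eq_iff dist_commute)
    then have "c * dist (x a) (x b) \<le> c * (2 * (real (Suc l) * \<delta>))"
      using jl(5) pos by (intro mult_left_mono) auto
    moreover have "h (x a) (x b) \<le> c * dist (x a) (x b)"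
      using that V(2) jl(1) x sq by (intro h(2)) (auto simp: doubleton_eq_iff)
    ultimately show ?thesis
      by (simp add: mult_ac)
  qed
  moreover have "edge_weight \<alpha> h x {i, j} = h (x (min i j)) (x (max i j)) powr \<alpha>"
    by (simp add: edge_weight_def)
  moreover have "{min i j, max i j} = {i, j}"
    by (auto simp: min_def max_def)
  ultimately have "edge_weight \<alpha> h x {i, j} \<le> (2 * c * real (Suc l) * \<delta>) powr \<alpha>"
    using pos h(1) by (simp only:) (intro powr_mono2, auto)
  also have "\<dots> = y * \<delta> powr \<alpha>"
    using pos \<delta> by (simp add: y_def powr_mult)
  also have "\<delta> powr \<alpha> = n powr (- \<alpha> / 2)"
    using n by (simp add: \<delta>_def powr_divide powr_half_sqrt[symmetric] powr_powr powr_minus_divide)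
  finally have w: "edge_weight \<alpha> h x {i, j} \<le> y * n powr (- \<alpha> / 2)" .
  have "y\<^sup>2 \<le> nbcost \<alpha> c V i x"
  proof -
    have "real l < sqrt n"
      using jl(3) n by (simp add: \<delta>_def field_simps)
    also have "sqrt n \<le> n"
      using n by (intro real_le_lsqrt) (auto simp: power2_eq_square)
    finally have l: "l \<in> {..card V}"
      by (simp add: n_def)
    have "y\<^sup>2 = (2 * c * real (Suc l)) powr (2 * \<alpha>)
      * indicator {x. lonely V i (real l / sqrt (real (card V))) x} x"
      using jl(4) pos by (simp add: y_def \<delta>_def n_def powr_powr[symmetric] powr_numeral mult.commute[of 2 \<alpha>])
    also have "\<dots> \<le> nbcost \<alpha> c V i x"
      unfolding nbcost_def by (rule member_le_sum[OF l]) auto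
    finally show ?thesis .
  qed
  have "y \<le> \<epsilon> * y\<^sup>2 + 1 / \<epsilon>"
  proof (cases "y \<le> 1 / \<epsilon>")
    case True
    then show ?thesis
      using pos by (simp add: add_increasing)
  next
    case False
    then have "1 * y \<le> (\<epsilon> * y) * y"
      using pos y0 by (intro mult_right_mono) (auto simp: field_simps)
    then have "y \<le> \<epsilon> * y\<^sup>2"
      by (simp add: power2_eq_square mult_ac)
    then show ?thesis
      using pos by (simp add: add_increasing2)
  qed
  also have "\<dots> \<le> \<epsilon> * nbcost \<alpha> c V i x + 1 / \<epsilon>"
    using \<open>y\<^sup>2 \<le> nbcost \<alpha> c V i x\<close> pos by simp
  finally have "y * n powr (- \<alpha> / 2) \<le> n powr (- \<alpha> / 2) * (\<epsilon> * nbcost \<alpha> c V i x + 1 / \<epsilon>)"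
    by (subst mult.commute) (rule mult_left_mono, simp_all)
  with w have "edge_weight \<alpha> h x {i, j} \<le> real (card V) powr (- \<alpha> / 2) * (\<epsilon> * nbcost \<alpha> c V i x + 1 / \<epsilon>)"
    by (simp add: n_def)
  with jl(1,2) that show ?thesis by blast
qed

lemma nbcost_series_summable:
  assumes "0 < \<alpha>" "0 < (c::real)"
  shows "summable (\<lambda>l. (2 * c * real (Suc l)) powr (2 * \<alpha>) * exp (- ((real l)\<^sup>2 / 2)))"
proof (rule summable_comparison_test_bigo)
  show "summable (\<lambda>l. norm (1 / real l ^ 2))"
    using inverse_power_summable[of 2] by (simp add: field_simps)
  show "(\<lambda>l. (2 * c * real (Suc l)) powr (2 * \<alpha>) * exp (- ((real l)\<^sup>2 / 2))) \<in> O(\<lambda>l. 1 / real l ^ 2)"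
    using assms by real_asymp
qed

lemma nn_integral_nbcost_le:
  fixes V :: "'v set"
  assumes V: "finite V" "i \<in> V" "2 \<le> card V" and pos: "0 < \<alpha>" "0 < c"
  shows "(\<integral>\<^sup>+x. ennreal (nbcost \<alpha> c V i x) \<partial>unif_points V)
    \<le> ennreal (\<Sum>l. (2 * c * real (Suc l)) powr (2 * \<alpha>) * exp (- ((real l)\<^sup>2 / 2)))"
    and "(\<lambda>x. ennreal (nbcost \<alpha> c V i x)) \<in> borel_measurable (unif_points V)"
proof -
  define n where "n = card V"
  define a where "a = (\<lambda>l. (2 * c * real (Suc l)) powr (2 * \<alpha>))"
  define L where "L = (\<lambda>l x. lonely V i (real l / sqrt (real n)) x)"
  have L: "{x \<in> space (unif_points V). L l x} \<in> sets (unif_points V)" for l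
    unfolding L_def using pred_lonely[OF V(1,2)] by (simp add: pred_def)
  have ind: "(\<lambda>x. indicator {x. L l x} x :: ennreal) \<in> borel_measurable (unif_points V)" for l
    using L[of l] by (simp add: borel_measurable_indicator_iff Int_def conj_commute)
  have a0: "0 \<le> a l" for l
    by (simp add: a_def)
  have eq: "ennreal (nbcost \<alpha> c V i x) = (\<Sum>l\<le>n. ennreal (a l) * indicator {x. L l x} x)" for x
  proof -
    have "ennreal (nbcost \<alpha> c V i x) = (\<Sum>l\<le>n. ennreal (a l * indicator {x. L l x} x))"
      unfolding nbcost_def a_def L_def n_def by (intro sum_ennreal[symmetric]) simp
    also have "\<dots> = (\<Sum>l\<le>n. ennreal (a l) * indicator {x. L l x} x)"
      by (intro sum.cong refl) (simp add: ennreal_mult a0 ennreal_indicator)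
    finally show ?thesis .
  qed
  show "(\<lambda>x. ennreal (nbcost \<alpha> c V i x)) \<in> borel_measurable (unif_points V)"
    unfolding eq by (intro borel_measurable_sum borel_measurable_times_ennreal borel_measurable_const ind)
  have "(\<integral>\<^sup>+x. ennreal (nbcost \<alpha> c V i x) \<partial>unif_points V)
    = (\<integral>\<^sup>+x. (\<Sum>l\<le>n. ennreal (a l) * indicator {x. L l x} x) \<partial>unif_points V)"
    by (simp only: eq)
  also have "\<dots> = (\<Sum>l\<le>n. \<integral>\<^sup>+x. ennreal (a l) * indicator {x. L l x} x \<partial>unif_points V)"
    by (rule nn_integral_sum) (intro borel_measurable_times_ennreal borel_measurable_const ind)
  also have "\<dots> = (\<Sum>l\<le>n. ennreal (a l) * (\<integral>\<^sup>+x. indicator {x. L l x} x \<partial>unif_points V))"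
    by (intro sum.cong refl nn_integral_cmult ind)
  also have "\<dots> \<le> (\<Sum>l\<le>n. ennreal (a l * exp (- ((real l)\<^sup>2 / 2))))"
  proof (rule sum_mono)
    fix l
    have "(\<integral>\<^sup>+x. indicator {x. L l x} x \<partial>unif_points V)
        = (\<integral>\<^sup>+x. indicator {x \<in> space (unif_points V). L l x} x \<partial>unif_points V)"
      by (intro nn_integral_cong) (simp add: indicator_def)
    also have "\<dots> = emeasure (unif_points V) {x \<in> space (unif_points V). L l x}"
      using L by simp
    also have "\<dots> \<le> ennreal (exp (- ((real l / sqrt (real n))\<^sup>2 * real (n - 1))))"
      unfolding L_def n_def by (rule emeasure_lonely_le[OF V(1,2)]) simp
    also have "\<dots> \<le> ennreal (exp (- ((real l)\<^sup>2 / 2)))"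
    proof -
      have "(1 / 2) * (real l)\<^sup>2 \<le> (real (n - 1) / real n) * (real l)\<^sup>2"
        using V(3) by (intro mult_right_mono) (auto simp: n_def field_simps)
      then show ?thesis
        by (intro ennreal_leI) (simp add: power_divide mult_ac)
    qed
    finally show "ennreal (a l) * (\<integral>\<^sup>+x. indicator {x. L l x} x \<partial>unif_points V)
        \<le> ennreal (a l * exp (- ((real l)\<^sup>2 / 2)))"
      using a0 by (simp add: ennreal_mult mult_left_mono)
  qed
  also have "\<dots> = ennreal (\<Sum>l\<le>n. a l * exp (- ((real l)\<^sup>2 / 2)))"
    using a0 by (simp add: sum_ennreal)
  also have "\<dots> \<le> ennreal (\<Sum>l. a l * exp (- ((real l)\<^sup>2 / 2)))"
    using nbcost_series_summable[OF pos] a0 unfolding a_def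
    by (intro ennreal_leI sum_le_suminf) auto
  finally show "(\<integral>\<^sup>+x. ennreal (nbcost \<alpha> c V i x) \<partial>unif_points V)
    \<le> ennreal (\<Sum>l. (2 * c * real (Suc l)) powr (2 * \<alpha>) * exp (- ((real l)\<^sup>2 / 2)))"
    by (simp add: a_def)
qed

section \<open>The trees of the cells of a grid\<close>

definition grid :: "nat \<Rightarrow> (nat \<times> nat) set" where
  "grid k = {..<k} \<times> {..<k}"

definition grid_cell :: "nat \<Rightarrow> nat \<times> nat \<Rightarrow> (real ^ 2) set" where
  "grid_cell k q = cell k (vector [real (fst q), real (snd q)])"

lemma mem_grid_cell:
  "0 < k \<Longrightarrow> x \<in> grid_cell k q \<longleftrightarrow>
    real (fst q) < real k * x $ 1 \<and> real k * x $ 1 < real (fst q) + 1 \<and>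
    real (snd q) < real k * x $ 2 \<and> real k * x $ 2 < real (snd q) + 1"
  by (auto simp: grid_cell_def cell_def cellmap_def mem_box_cart forall_2 field_simps)

lemma grid_cell_subset:
  assumes "q \<in> grid k"
  shows "grid_cell k q \<subseteq> box 0 1"
proof
  fix x assume x: "x \<in> grid_cell k q"
  have k: "0 < k" and q: "fst q + 1 \<le> k" "snd q + 1 \<le> k"
    using assms by (auto simp: grid_def)
  have *: "0 < t \<and> t < 1" if "real a < real k * t" "real k * t < real a + 1" "a + 1 \<le> k" for a t
  proof -
    have "0 < real k * t"
      using that(1) by linarith
    moreover have "real k * t < real k * 1"
      using that(2,3) by linarith
    ultimately show ?thesis
      using k by (simp add: zero_less_mult_iff)
  qed
  show "x \<in> box 0 1"
    using x q * unfolding mem_grid_cell[OF k] by (auto simp: mem_box_cart forall_2)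
qed

lemma grid_cell_disjoint:
  assumes "0 < k" "x \<in> grid_cell k q" "x \<in> grid_cell k q'"
  shows "q = q'"
proof -
  have "fst q = fst q'" "snd q = snd q'"
    using assms by (auto simp: mem_grid_cell)
  then show ?thesis
    by (rule prod_eqI)
qed

lemma grid_cell_sets: "grid_cell k q \<in> sets borel"
  by (simp add: grid_cell_def cell_sets)

lemma emeasure_grid_cell:
  assumes "q \<in> grid k"
  shows "emeasure unif (grid_cell k q) = ennreal (1 / (real k)\<^sup>2)"
proof -
  have k: "0 < k"
    using assms by (auto simp: grid_def)
  have eq: "grid_cell k q = box ((1 / real k) *\<^sub>R vector [real (fst q), real (snd q)])
      ((1 / real k) *\<^sub>R vector [real (fst q), real (snd q)] + (1 / real k) *\<^sub>R 1)"
    by (simp add: grid_cell_def cell_def cellmap_def scaleR_add_right)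
  show ?thesis
    using emeasure_unif[OF grid_cell_sets grid_cell_subset[OF assms]]
      emeasure_lborel_square(1)[of "1 / real k"] by (simp add: eq power_divide)
qed

text \<open>
  The exponential moment \<open>exp (s * (m - N))\<close>, where \<open>N\<close> is the number of points in the cell. It
  dominates the indicator of \<open>N < m\<close>, and its product form makes its mean explicit.
\<close>

definition deficit :: "nat \<Rightarrow> real \<Rightarrow> nat \<Rightarrow> 'v set \<Rightarrow> nat \<times> nat \<Rightarrow> ('v \<Rightarrow> real ^ 2) \<Rightarrow> real" where
  "deficit k s m V q x = exp (s * real m) * (\<Prod>i\<in>V. if x i \<in> grid_cell k q then exp (- s) else 1)"

lemma deficit_nonneg: "0 \<le> deficit k s m V q x"
  unfolding deficit_def by (intro mult_nonneg_nonneg prod_nonneg) auto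

lemma deficit_ge_1:
  assumes "finite V" "0 \<le> s" "card {j \<in> V. x j \<in> grid_cell k q} < m"
  shows "1 \<le> deficit k s m V q x"
proof -
  have "(\<Prod>i\<in>V. if x i \<in> grid_cell k q then exp (- s) else 1)
      = exp (- s) ^ card {j \<in> V. x j \<in> grid_cell k q}"
    using assms(1) by (simp add: prod.If_cases Int_def)
  then have "deficit k s m V q x = exp (s * (real m - real (card {j \<in> V. x j \<in> grid_cell k q})))"
    by (simp add: deficit_def exp_of_nat_mult[symmetric] exp_add[symmetric] algebra_simps)
  then show ?thesis
    using assms(2,3) by simp
qed

lemma nn_integral_deficit:
  assumes V: "finite V" and q: "q \<in> grid k" and s: "0 \<le> s"
  shows "(\<integral>\<^sup>+x. ennreal (deficit k s m V q x) \<partial>unif_points V)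
    \<le> ennreal (exp (s * real m) * exp (- (real (card V) / (real k)\<^sup>2 * (1 - exp (- s)))))"
    and "(\<lambda>x. ennreal (deficit k s m V q x)) \<in> borel_measurable (unif_points V)"
proof -
  define p where "p = 1 / (real k)\<^sup>2"
  have "0 < k"
    using q by (auto simp: grid_def)
  then have p: "0 \<le> p" "p \<le> 1"
    by (auto simp: p_def)
  have Q: "grid_cell k q \<in> sets unif"
    by (rule sets_unif[OF grid_cell_sets grid_cell_subset[OF q]])
  define g where "g = (\<lambda>y. ennreal (if y \<in> grid_cell k q then exp (- s) else 1))"
  have gm: "g \<in> borel_measurable borel"
    unfolding g_def using grid_cell_sets[of k q] by measurable
  have gi: "g \<in> borel_measurable unif"
    using measurable_compose[OF measurable_unif_borel gm] by simp
  have eq: "ennreal (deficit k s m V q x) = ennreal (exp (s * real m)) * (\<Prod>i\<in>V. g (x i))" for x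
    unfolding deficit_def g_def by (subst prod_ennreal) (auto simp: ennreal_mult prod_nonneg)
  have pm: "(\<lambda>x. \<Prod>i\<in>V. g (x i)) \<in> borel_measurable (unif_points V)"
    by (intro borel_measurable_prod_ennreal measurable_compose[OF measurable_PiM_unif_component gm])
  then show "(\<lambda>x. ennreal (deficit k s m V q x)) \<in> borel_measurable (unif_points V)"
    unfolding eq by (intro borel_measurable_times_ennreal borel_measurable_const)
  have "(\<integral>\<^sup>+y. g y \<partial>unif) = (\<integral>\<^sup>+y. ennreal (exp (- s)) * indicator (grid_cell k q) y
      + indicator (space unif - grid_cell k q) y \<partial>unif)"
    by (intro nn_integral_cong) (auto simp: g_def indicator_def)
  also have "\<dots> = ennreal (exp (- s)) * emeasure unif (grid_cell k q) + emeasure unif (space unif - grid_cell k q)"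
    using Q by (subst nn_integral_add) (auto simp: nn_integral_cmult_indicator)
  also have "emeasure unif (space unif - grid_cell k q) = emeasure unif (space unif) - emeasure unif (grid_cell k q)"
    using Q emeasure_grid_cell[OF q] by (intro emeasure_compl) auto
  also have "\<dots> = ennreal (1 - p)"
    using p by (simp add: emeasure_grid_cell[OF q] p_def prob_space.emeasure_space_1[OF prob_space_unif]
        ennreal_minus[symmetric])
  also have "ennreal (exp (- s)) * emeasure unif (grid_cell k q) + ennreal (1 - p) = ennreal (1 - p * (1 - exp (- s)))"
    using p by (simp add: emeasure_grid_cell[OF q] p_def[symmetric] ennreal_mult[symmetric] ennreal_plus[symmetric]
        algebra_simps del: ennreal_plus)
  finally have one: "(\<integral>\<^sup>+y. g y \<partial>unif) = ennreal (1 - p * (1 - exp (- s)))" .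
  have nn: "0 \<le> 1 - p * (1 - exp (- s))"
    using p s mult_mono[of p 1 "1 - exp (- s)" 1] by simp
  have "(\<integral>\<^sup>+x. ennreal (deficit k s m V q x) \<partial>unif_points V)
      = ennreal (exp (s * real m)) * (\<integral>\<^sup>+x. (\<Prod>i\<in>V. g (x i)) \<partial>unif_points V)"
    unfolding eq by (rule nn_integral_cmult[OF pm])
  also have "(\<integral>\<^sup>+x. (\<Prod>i\<in>V. g (x i)) \<partial>unif_points V) = (\<Prod>i\<in>V. \<integral>\<^sup>+y. g y \<partial>unif)"
    by (rule product_sigma_finite.product_nn_integral_prod[OF product_sigma_finite_unif V gi])
  also have "\<dots> = ennreal ((1 - p * (1 - exp (- s))) ^ card V)"
    using nn by (simp add: one ennreal_power)
  also have "\<dots> \<le> ennreal (exp (- (real (card V) / (real k)\<^sup>2 * (1 - exp (- s)))))"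
  proof (rule ennreal_leI)
    have "(1 - p * (1 - exp (- s))) ^ card V \<le> exp (- (p * (1 - exp (- s)))) ^ card V"
      using nn exp_ge_add_one_self[of "- (p * (1 - exp (- s)))"] by (intro power_mono) auto
    also have "\<dots> = exp (- (real (card V) / (real k)\<^sup>2 * (1 - exp (- s))))"
      by (simp add: exp_of_nat_mult[symmetric] p_def)
    finally show "(1 - p * (1 - exp (- s))) ^ card V
      \<le> exp (- (real (card V) / (real k)\<^sup>2 * (1 - exp (- s))))" .
  qed
  finally show "(\<integral>\<^sup>+x. ennreal (deficit k s m V q x) \<partial>unif_points V)
    \<le> ennreal (exp (s * real m) * exp (- (real (card V) / (real k)\<^sup>2 * (1 - exp (- s)))))"
    by (simp add: ennreal_mult mult_left_mono)
qed

text \<open>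
  At most one summand is present, namely the tree on the first \<open>m\<close> points of the cell, and none
  if there are fewer points. As a sum over fixed index sets it can be integrated term by term.
\<close>

definition cell_trees :: "real \<Rightarrow> (real ^ 2 \<Rightarrow> real ^ 2 \<Rightarrow> real) \<Rightarrow> nat \<Rightarrow> nat \<Rightarrow> nat set \<Rightarrow> nat \<times> nat
    \<Rightarrow> (nat \<Rightarrow> real ^ 2) \<Rightarrow> real" where
  "cell_trees \<alpha> h k m V q x = (\<Sum>I\<in>{I. I \<subseteq> V \<and> card I = m}.
      mst_on \<alpha> h I x * indicator {x. initial_part {j \<in> V. x j \<in> grid_cell k q} I} x)"

text \<open>
  The attached points are those outside the cell trees and the lowest point of each tree. If \<open>K\<close>
  is the set of cells with a tree, there are \<open>card V - (m - 1) * card K\<close> of them, and the sum of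
  \<open>deficit\<close> dominates the number of cells without a tree.
\<close>

lemma mst_on_le_cell_trees:
  fixes V :: "nat set"
  assumes V: "finite V" "V \<noteq> {}" and x: "\<And>j. j \<in> V \<Longrightarrow> x j \<in> box 0 1"
    and pos: "0 < \<alpha>" "0 < c" "0 < \<epsilon>" "0 < m" "0 \<le> s"
    and h: "\<And>u v. 0 \<le> h u v" "\<And>u v. u \<in> unit_square \<Longrightarrow> v \<in> unit_square \<Longrightarrow> h u v \<le> c * dist u v"
  shows "mst_on \<alpha> h V x \<le> (\<Sum>q\<in>grid k. cell_trees \<alpha> h k m V q x)
    + real (card V) powr (- \<alpha> / 2) * (\<epsilon> * (\<Sum>i\<in>V. nbcost \<alpha> c V i x)
      + (real (card V) - (real m - 1) * (real k)\<^sup>2 + (real m - 1) * (\<Sum>q\<in>grid k. deficit k s m V q x)) / \<epsilon>)"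
proof -
  define J where "J = (\<lambda>q. {j \<in> V. x j \<in> grid_cell k q})"
  define K where "K = {q \<in> grid k. m \<le> card (J q)}"
  have fin_grid: "finite (grid k)" and fK: "finite K" and KG: "K \<subseteq> grid k"
    by (auto simp: grid_def K_def)
  have finJ: "finite (J q)" "J q \<subseteq> V" for q
    using V by (auto simp: J_def)
  have "\<exists>I. initial_part (J q) I \<and> card I = m" if "q \<in> K" for q
    using initial_part_exists[OF finJ(1)] that by (auto simp: K_def)
  then obtain G where G: "\<And>q. q \<in> K \<Longrightarrow> initial_part (J q) (G q) \<and> card (G q) = m"
    by metis
  have GJ: "G q \<subseteq> J q" if "q \<in> K" for q
    using G[OF that] by (auto simp: initial_part_def)
  have GV: "G q \<subseteq> V \<and> G q \<noteq> {}" if "q \<in> K" for q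
    using subset_trans[OF GJ[OF that] finJ(2)] G[OF that] pos by auto
  have finG: "finite (G q)" if "q \<in> K" for q
    using GV[OF that] V finite_subset by blast
  define \<rho> where "\<rho> = (\<lambda>j. supnorm (x j))"
  define L where "L = (\<lambda>q. lowest \<rho> (G q)) ` K"
  define U where "U = (V - \<Union> (G ` K)) \<union> L"
  have LG: "lowest \<rho> (G q) \<in> G q" if "q \<in> K" for q
    using lowest(1)[OF finG[OF that]] GV[OF that] by blast
  have LV: "lowest \<rho> (G q) \<in> V" if "q \<in> K" for q
    using LG[OF that] GV[OF that] by blast
  have U: "U \<subseteq> V" "V \<subseteq> U \<union> \<Union> (G ` K)" "\<And>q. q \<in> K \<Longrightarrow> lowest \<rho> (G q) \<in> U"
    using LV by (auto simp: U_def L_def)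
  have finU: "finite U"
    using U(1) V finite_subset by blast
  define B where "B = (\<lambda>i. real (card V) powr (- \<alpha> / 2) * (\<epsilon> * nbcost \<alpha> c V i x + 1 / \<epsilon>))"
  have B0: "0 \<le> B i" for i
    using pos nbcost_nonneg[of \<alpha> c V i x] by (simp add: B_def)
  have "\<exists>j. j \<in> V \<and> lower \<rho> j i \<and> edge_weight \<alpha> h x {i, j} \<le> B i" if "i \<in> U" "i \<noteq> lowest \<rho> V" for i
    using cheap_lower_neighbour[where V = V and i = i and x = x and \<alpha> = \<alpha> and c = c and \<epsilon> = \<epsilon> and h = h]
      V(1) U(1) x that pos h unfolding \<rho>_def B_def by (metis subsetD)
  then obtain nb where nb: "\<And>i. i \<in> U \<Longrightarrow> i \<noteq> lowest \<rho> V \<Longrightarrow>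
      nb i \<in> V \<and> lower \<rho> (nb i) i \<and> edge_weight \<alpha> h x {i, nb i} \<le> B i"
    by metis
  have "mst_on \<alpha> h V x \<le> (\<Sum>q\<in>K. mst_on \<alpha> h (G q) x) + (\<Sum>i\<in>U - {lowest \<rho> V}. edge_weight \<alpha> h x {i, nb i})"
    by (rule mst_weight_le_glued[OF V fK GV edge_weight_nonneg U]) (use nb in auto)
  also have "(\<Sum>q\<in>K. mst_on \<alpha> h (G q) x) \<le> (\<Sum>q\<in>grid k. cell_trees \<alpha> h k m V q x)"
  proof -
    have nn: "0 \<le> mst_on \<alpha> h I x * indicator A x" if "I \<subseteq> V" "card I = m" for I A
    proof -
      have "finite I" "I \<noteq> {}"
        using that V pos finite_subset by (auto simp: card_gt_0_iff)
      then show ?thesis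
        using mst_weight_nonneg[of I "edge_weight \<alpha> h x"] by (simp add: edge_weight_nonneg)
    qed
    have "(\<Sum>q\<in>K. mst_on \<alpha> h (G q) x) \<le> (\<Sum>q\<in>K. cell_trees \<alpha> h k m V q x)"
    proof (rule sum_mono)
      fix q assume q: "q \<in> K"
      have "mst_on \<alpha> h (G q) x
          = mst_on \<alpha> h (G q) x * indicator {x. initial_part {j \<in> V. x j \<in> grid_cell k q} (G q)} x"
        using G[OF q] by (simp add: J_def)
      also have "\<dots> \<le> cell_trees \<alpha> h k m V q x"
        unfolding cell_trees_def
        by (rule member_le_sum) (use G[OF q] GV[OF q] V nn in auto)
      finally show "mst_on \<alpha> h (G q) x \<le> cell_trees \<alpha> h k m V q x" .
    qed
    also have "\<dots> \<le> (\<Sum>q\<in>grid k. cell_trees \<alpha> h k m V q x)"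
      using fin_grid KG nn by (intro sum_mono2) (auto simp: cell_trees_def intro!: sum_nonneg)
    finally show ?thesis .
  qed
  also have "(\<Sum>i\<in>U - {lowest \<rho> V}. edge_weight \<alpha> h x {i, nb i}) \<le> (\<Sum>i\<in>U - {lowest \<rho> V}. B i)"
    using nb by (intro sum_mono) auto
  also have "\<dots> \<le> (\<Sum>i\<in>U. B i)"
    using finU B0 by (intro sum_mono2) auto
  also have "\<dots> = real (card V) powr (- \<alpha> / 2) * (\<epsilon> * (\<Sum>i\<in>U. nbcost \<alpha> c V i x) + real (card U) / \<epsilon>)"
    by (simp add: B_def sum_distrib_left[symmetric] sum.distrib)
  also have "\<dots> \<le> real (card V) powr (- \<alpha> / 2) * (\<epsilon> * (\<Sum>i\<in>V. nbcost \<alpha> c V i x)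
      + (real (card V) - (real m - 1) * (real k)\<^sup>2 + (real m - 1) * (\<Sum>q\<in>grid k. deficit k s m V q x)) / \<epsilon>)"
  proof -
    have "(\<Sum>i\<in>U. nbcost \<alpha> c V i x) \<le> (\<Sum>i\<in>V. nbcost \<alpha> c V i x)"
      by (intro sum_mono2 V U nbcost_nonneg)
    moreover have "real (card U) \<le> real (card V) - (real m - 1) * (real k)\<^sup>2
        + (real m - 1) * (\<Sum>q\<in>grid k. deficit k s m V q x)"
    proof -
      have "G q \<inter> G q' = {}" if "q \<in> K" "q' \<in> K" "q \<noteq> q'" for q q'
      proof -
        have "0 < k"
          using that KG by (auto simp: grid_def)
        then show ?thesis
          using GJ that grid_cell_disjoint[of k] by (fastforce simp: J_def)
      qed
      then have cardG: "card (\<Union> (G ` K)) = m * card K"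
        using fK finG G by (subst card_UN_disjoint) auto
      have "card U \<le> card (V - \<Union> (G ` K)) + card L"
        unfolding U_def by (rule card_Un_le)
      also have "card L \<le> card K"
        unfolding L_def by (rule card_image_le[OF fK])
      also have "card (V - \<Union> (G ` K)) = card V - m * card K"
        using V GV fK finG by (subst card_Diff_subset) (auto simp: cardG)
      finally have "card U \<le> card V - m * card K + card K"
        by simp
      moreover have "m * card K \<le> card V"
        unfolding cardG[symmetric] using V GV by (intro card_mono) auto
      ultimately have "real (card U) \<le> real (card V) - real m * real (card K) + real (card K)"
        by (metis of_nat_add of_nat_diff of_nat_le_iff of_nat_mult)
      also have "\<dots> = real (card V) - (real m - 1) * real (card K)"
        by (simp add: algebra_simps)
      finally have "real (card U) \<le> real (card V) - (real m - 1) * real (card K)" .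
      moreover have "(real m - 1) * real (card K) \<ge> (real m - 1) * ((real k)\<^sup>2 - (\<Sum>q\<in>grid k. deficit k s m V q x))"
      proof (rule mult_left_mono)
        have "(real k)\<^sup>2 = (\<Sum>q\<in>grid k. 1)"
          by (simp add: grid_def power2_eq_square)
        also have "\<dots> \<le> (\<Sum>q\<in>grid k. (if q \<in> K then 1 else 0) + deficit k s m V q x)"
        proof (rule sum_mono)
          fix q assume "q \<in> grid k"
          then show "1 \<le> (if q \<in> K then 1 else 0) + deficit k s m V q x"
            using deficit_ge_1[OF V(1) pos(5), of x k q m] deficit_nonneg[of k s m V q x]
            by (auto simp: K_def J_def not_le)
        qed
        also have "\<dots> = real (card K) + (\<Sum>q\<in>grid k. deficit k s m V q x)"
          using fin_grid KG by (simp add: sum.distrib sum.If_cases Int_absorb1)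
        finally show "(real k)\<^sup>2 - (\<Sum>q\<in>grid k. deficit k s m V q x) \<le> real (card K)"
          by simp
      qed (use pos in simp)
      ultimately show ?thesis
        by (simp add: algebra_simps)
    qed
    ultimately show ?thesis
      using pos by (intro mult_left_mono add_mono divide_right_mono) auto
  qed
  finally show ?thesis
    by simp
qed

text \<open>
  Conditionally on the labels of the first \<open>m\<close> points in the cell, the mean cost of their tree is at
  most the mean on \<open>m\<close> points of the square times the rescaling factor. The events
  that these labels form a given set are disjoint, so their probabilities sum to at most one.
\<close>

lemma nn_integral_cell_trees_le:
  assumes V: "finite V" and q: "q \<in> grid k" and m: "0 < m"
    and h: "(\<lambda>(u, v). h u v) \<in> borel_measurable (borel \<Otimes>\<^sub>M borel)" "\<And>u v. 0 \<le> h u v"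
    and b1: "\<And>a u v. a > 0 \<Longrightarrow> h (a *\<^sub>R u) (a *\<^sub>R v) = a * h u v"
    and b2: "\<And>b u v. h (b + u) (b + v) \<le> h0 * h u v" and pos: "0 < \<alpha>" "0 < h0"
  shows "(\<integral>\<^sup>+x. ennreal (cell_trees \<alpha> h k m V q x) \<partial>unif_points V)
    \<le> ennreal (h0 powr \<alpha> * real k powr (- \<alpha>)) * (\<integral>\<^sup>+x. ennreal (MST \<alpha> h x m) \<partial>unif_points {1..m})"
    (is "_ \<le> ?r * ?E")
    and "(\<lambda>x. ennreal (cell_trees \<alpha> h k m V q x)) \<in> borel_measurable (unif_points V)"
proof -
  define S where "S = {I. I \<subseteq> V \<and> card I = m}"
  have S: "finite S" "\<And>I. I \<in> S \<Longrightarrow> finite I \<and> I \<noteq> {} \<and> I \<subseteq> V"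
    using V m finite_subset[OF _ V] by (auto simp: S_def)
  have k: "0 < k"
    using q by (auto simp: grid_def)
  define F where "F = (\<lambda>I. {x. initial_part {j \<in> V. x j \<in> grid_cell k q} I})"
  define A where "A = (\<lambda>I. {x \<in> space (unif_points V). initial_part {j \<in> V. x j \<in> grid_cell k q} I})"
  have A: "A I \<in> sets (unif_points V)" if "I \<in> S" for I
    unfolding A_def using S(2)[OF that] by (intro sets_initial_part_cell V grid_cell_sets) auto
  have mm: "(\<lambda>x. ennreal (mst_on \<alpha> h I x)) \<in> borel_measurable (unif_points K)" if "I \<in> S" "I \<subseteq> K" for I K
    using S(2)[OF that(1)] that(2)
    by (intro measurable_compose[OF measurable_mst_on measurable_ennreal] h(1) measurable_PiM_unif_component) auto
  have mst0: "0 \<le> mst_on \<alpha> h I x" if "I \<in> S" for I x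
    using S(2)[OF that] by (intro mst_weight_nonneg edge_weight_nonneg) auto
  have indm: "(\<lambda>x. indicator (F I) x :: ennreal) \<in> borel_measurable (unif_points V)" if "I \<in> S" for I
    using A[OF that] by (simp add: borel_measurable_indicator_iff A_def F_def Int_def conj_commute)
  have eq: "ennreal (cell_trees \<alpha> h k m V q x) = (\<Sum>I\<in>S. ennreal (mst_on \<alpha> h I x) * indicator (F I) x)" for x
  proof -
    have "ennreal (cell_trees \<alpha> h k m V q x) = (\<Sum>I\<in>S. ennreal (mst_on \<alpha> h I x * indicator (F I) x))"
      unfolding cell_trees_def S_def[symmetric] F_def using mst0 by (intro sum_ennreal[symmetric]) simp
    also have "\<dots> = (\<Sum>I\<in>S. ennreal (mst_on \<alpha> h I x) * indicator (F I) x)"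
      using mst0 by (intro sum.cong refl) (simp add: ennreal_mult ennreal_indicator)
    finally show ?thesis .
  qed
  have termm: "(\<lambda>x. ennreal (mst_on \<alpha> h I x) * indicator (F I) x) \<in> borel_measurable (unif_points V)"
    if "I \<in> S" for I
    using S(2)[OF that] that by (intro borel_measurable_times_ennreal mm indm) auto
  show "(\<lambda>x. ennreal (cell_trees \<alpha> h k m V q x)) \<in> borel_measurable (unif_points V)"
    unfolding eq by (intro borel_measurable_sum termm)
  have "(\<integral>\<^sup>+x. ennreal (cell_trees \<alpha> h k m V q x) \<partial>unif_points V)
    = (\<Sum>I\<in>S. \<integral>\<^sup>+x. ennreal (mst_on \<alpha> h I x) * indicator (F I) x \<partial>unif_points V)"
    unfolding eq by (rule nn_integral_sum[OF termm])
  also have "\<dots> \<le> (\<Sum>I\<in>S. (?r * ?E) * emeasure (unif_points V) (A I))"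
  proof (rule sum_mono)
    fix I assume I: "I \<in> S"
    note I' = S(2)[OF I]
    define b :: "real ^ 2" where "b = vector [real (fst q), real (snd q)]"
    have cell: "grid_cell k q = cell k b"
      by (simp add: grid_cell_def b_def)
    have "(\<integral>\<^sup>+x. ennreal (mst_on \<alpha> h I x) * indicator (F I) x \<partial>unif_points V)
      = (\<integral>\<^sup>+x. ennreal (mst_on \<alpha> h I (restrict x I)) * indicator (F I) x \<partial>unif_points V)"
      by (simp only: mst_on_restrict)
    also have "\<dots> = (\<integral>\<^sup>+u. ennreal (mst_on \<alpha> h I (\<lambda>i\<in>I. cellmap k b (u i))) \<partial>unif_points I)
        * emeasure (unif_points V) (A I)"
      unfolding F_def A_def cell
      using I' grid_cell_subset[OF q] I
      by (intro nn_integral_initial_part_cell k V mm) (auto simp: cell)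
    also have "(\<integral>\<^sup>+u. ennreal (mst_on \<alpha> h I (\<lambda>i\<in>I. cellmap k b (u i))) \<partial>unif_points I) \<le> ?r * ?E"
    proof -
      have "(\<integral>\<^sup>+u. ennreal (mst_on \<alpha> h I (\<lambda>i\<in>I. cellmap k b (u i))) \<partial>unif_points I)
        \<le> (\<integral>\<^sup>+u. ?r * ennreal (mst_on \<alpha> h I u) \<partial>unif_points I)"
      proof (rule nn_integral_mono)
        fix u
        have "mst_on \<alpha> h I (\<lambda>i\<in>I. cellmap k b (u i)) \<le> h0 powr \<alpha> * real k powr (- \<alpha>) * mst_on \<alpha> h I u"
          using I' by (intro mst_on_cellmap_le b1 b2 h(2) k pos) auto
        then show "ennreal (mst_on \<alpha> h I (\<lambda>i\<in>I. cellmap k b (u i))) \<le> ?r * ennreal (mst_on \<alpha> h I u)"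
          using mst0[OF I, of u] by (simp add: ennreal_mult[symmetric] ennreal_leI)
      qed
      also have "\<dots> = ?r * (\<integral>\<^sup>+u. ennreal (mst_on \<alpha> h I u) \<partial>unif_points I)"
        by (rule nn_integral_cmult[OF mm[OF I order_refl]])
      also have "\<dots> \<le> ?r * ?E"
        using I' I m by (intro mult_left_mono nn_integral_mst_on_relabel_le h(1)) (auto simp: S_def)
      finally show ?thesis .
    qed
    finally show "(\<integral>\<^sup>+x. ennreal (mst_on \<alpha> h I x) * indicator (F I) x \<partial>unif_points V)
        \<le> (?r * ?E) * emeasure (unif_points V) (A I)"
      by (simp add: mult_right_mono)
  qed
  also have "\<dots> = (?r * ?E) * (\<Sum>I\<in>S. emeasure (unif_points V) (A I))"
    by (rule sum_distrib_left[symmetric])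
  also have "(\<Sum>I\<in>S. emeasure (unif_points V) (A I)) = emeasure (unif_points V) (\<Union>I\<in>S. A I)"
  proof (rule sum_emeasure[OF _ _ S(1)])
    show "disjoint_family_on A S"
      unfolding disjoint_family_on_def A_def S_def using initial_part_unique V by fastforce
  qed (use A in auto)
  also have "\<dots> \<le> emeasure (unif_points V) (space (unif_points V))"
    by (rule emeasure_space)
  also have "\<dots> = 1"
    by (rule emeasure_PiM_unif_space)
  finally show "(\<integral>\<^sup>+x. ennreal (cell_trees \<alpha> h k m V q x) \<partial>unif_points V) \<le> ?r * ?E"
    by (simp add: mult_left_mono)
qed

section \<open>Bounds for the mean tree weight\<close>

lemma nn_integral_close_pair_le:
  fixes V :: "'v set"
  assumes V: "finite V" "i \<in> V" "j \<in> V" "i \<noteq> j" and t: "0 \<le> t"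
  shows "(\<integral>\<^sup>+x. indicator {x. dist (x i) (x j) \<le> t} x \<partial>unif_points V) \<le> ennreal (4 * t\<^sup>2)"
    and "(\<lambda>x. indicator {x. dist (x i) (x j) \<le> t} x :: ennreal) \<in> borel_measurable (unif_points V)"
proof -
  define J where "J = V - {j}"
  have J: "finite J" "j \<notin> J" "insert j J = V"
    using V by (auto simp: J_def)
  define f where "f = (\<lambda>x :: 'v \<Rightarrow> real ^ 2. indicator {x. dist (x i) (x j) \<le> t} x :: ennreal)"
  have "{x \<in> space (unif_points V). dist (x i) (x j) \<le> t} \<in> sets (unif_points V)"
    by (intro borel_measurable_le borel_measurable_dist borel_measurable_const
        measurable_PiM_unif_component V)
  then show fm: "f \<in> borel_measurable (unif_points V)"
    unfolding f_def by (simp add: borel_measurable_indicator_iff Int_def conj_commute)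
  have "(\<integral>\<^sup>+x. f x \<partial>unif_points V) = (\<integral>\<^sup>+x. \<integral>\<^sup>+y. f (x(j := y)) \<partial>unif \<partial>unif_points J)"
    using product_sigma_finite.product_nn_integral_insert[OF product_sigma_finite_unif J(1,2), of f] fm J(3)
    by simp
  also have "\<dots> \<le> (\<integral>\<^sup>+x. ennreal (4 * t\<^sup>2) \<partial>unif_points J)"
  proof (rule nn_integral_mono)
    fix x :: "'v \<Rightarrow> real ^ 2"
    define B where "B = cbox (x i - t *\<^sub>R 1) (x i - t *\<^sub>R 1 + (2 * t) *\<^sub>R 1)"
    have "(\<integral>\<^sup>+y. f (x(j := y)) \<partial>unif) = (\<integral>\<^sup>+y. f (x(j := y)) * indicator (box 0 1) y \<partial>lborel)"
      unfolding unif_def by (subst nn_integral_restrict_space) auto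
    also have "\<dots> \<le> (\<integral>\<^sup>+y. indicator B y \<partial>lborel)"
    proof (rule nn_integral_mono)
      fix y
      have "y \<in> B" if "dist (x i) y \<le> t"
      proof -
        have "\<bar>x i $ c - y $ c\<bar> \<le> t" for c
          using component_le_norm_cart[of "x i - y" c] that by (simp add: dist_norm)
        then show ?thesis
          by (auto simp: B_def mem_box_cart abs_le_iff) (smt (verit))+
      qed
      then show "f (x(j := y)) * indicator (box 0 1) y \<le> indicator B y"
        using V(4) by (auto simp: f_def indicator_def)
    qed
    also have "\<dots> = ennreal (4 * t\<^sup>2)"
      using emeasure_lborel_square(2)[of "2 * t" "x i - t *\<^sub>R 1"] t
      by (simp add: B_def power_mult_distrib)
    finally show "(\<integral>\<^sup>+y. f (x(j := y)) \<partial>unif) \<le> ennreal (4 * t\<^sup>2)" .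
  qed
  also have "\<dots> = ennreal (4 * t\<^sup>2)"
    by (simp add: emeasure_PiM_unif_space)
  finally show "(\<integral>\<^sup>+x. indicator {x. dist (x i) (x j) \<le> t} x \<partial>unif_points V) \<le> ennreal (4 * t\<^sup>2)"
    by (simp add: f_def)
qed

text \<open>
  Every vertex of a connected graph with another vertex has an edge, and an edge covers two vertices.
\<close>

lemma card_spanning_tree_ge:
  assumes T: "T \<in> spanning_trees V" and V: "finite V" "2 \<le> card V"
  shows "card V \<le> 2 * card T"
proof -
  have sub: "T \<subseteq> complete_edges V"
    using T by (simp add: spanning_trees_def)
  then have fin: "finite T"
    using finite_complete_edges[OF V(1)] finite_subset by blast
  have "V \<subseteq> \<Union> T"
  proof
    fix v assume v: "v \<in> V"
    have "V \<noteq> {v}"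
      using V by auto
    then obtain u where u: "u \<in> V" "u \<noteq> v"
      using v by auto
    then have "(v, u) \<in> (adj T)\<^sup>*"
      using T v by (auto simp: spanning_trees_def connected_graph_adj)
    then show "v \<in> \<Union> T"
      using u(2) by (cases rule: converse_rtranclE) (auto simp: adj_iff)
  qed
  moreover have "finite (\<Union> T)"
    using sub V(1) by (intro finite_subset[of "\<Union> T" V]) (auto simp: complete_edges_def)
  ultimately have "card V \<le> card (\<Union> T)"
    by (intro card_mono)
  also have "\<dots> \<le> (\<Sum>e\<in>T. card e)"
    by (rule card_Union_le_sum_card)
  also have "\<dots> = (\<Sum>e\<in>T. 2)"
    using sub by (intro sum.cong) (auto simp: complete_edges_def)
  finally show ?thesis
    by simp
qed

definition mean_mst :: "real \<Rightarrow> (real ^ 2 \<Rightarrow> real ^ 2 \<Rightarrow> real) \<Rightarrow> nat \<Rightarrow> ennreal" where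
  "mean_mst \<alpha> h n = (\<integral>\<^sup>+x. ennreal (MST \<alpha> h x n) \<partial>unif_points {1..n})"

definition nb_const :: "real \<Rightarrow> real \<Rightarrow> real" where
  "nb_const \<alpha> c = (\<Sum>l. (2 * c * real (Suc l)) powr (2 * \<alpha>) * exp (- ((real l)\<^sup>2 / 2)))"

lemma unit_box_subset_square: "p \<in> box 0 1 \<Longrightarrow> p \<in> unit_square"
  using box_subset_cbox[of 0 "1 :: real ^ 2"] by (auto simp: unit_square_def)

locale homogeneous_weight =
  fixes h :: "real ^ 2 \<Rightarrow> real ^ 2 \<Rightarrow> real" and \<alpha> c1 c2 h0 :: real
  assumes pos: "0 < \<alpha>" "0 < c1" "0 < c2" "0 < h0"
    and h_measurable: "(\<lambda>(u, v). h u v) \<in> borel_measurable (borel \<Otimes>\<^sub>M borel)"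
    and h_nonneg: "0 \<le> h u v"
    and h_lower: "x \<in> unit_square \<Longrightarrow> y \<in> unit_square \<Longrightarrow> c1 * dist x y \<le> h x y"
    and h_upper: "x \<in> unit_square \<Longrightarrow> y \<in> unit_square \<Longrightarrow> h x y \<le> c2 * dist x y"
    and h_scale: "0 < a \<Longrightarrow> h (a *\<^sub>R u) (a *\<^sub>R v) = a * h u v"
    and h_shift: "h (b + u) (b + v) \<le> h0 * h u v"
begin

text \<open>
  The integrated form of \<open>mst_on_le_cell_trees\<close>. The case \<open>k = 0\<close> is allowed: the grid is then empty
  and the first summand vanishes.
\<close>

lemma mean_mst_step:
  assumes n: "2 \<le> n" and m: "0 < m" and e: "0 < \<epsilon>" and s: "0 \<le> s"
    and k: "(real m - 1) * (real k)\<^sup>2 \<le> real n"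
  shows "mean_mst \<alpha> h n \<le> ennreal ((real k)\<^sup>2 * (h0 powr \<alpha> * real k powr (- \<alpha>))) * mean_mst \<alpha> h m
    + ennreal (real n powr (- \<alpha> / 2) * (\<epsilon> * (real n * nb_const \<alpha> c2)
      + (real n - (real m - 1) * (real k)\<^sup>2
         + (real m - 1) * (real k)\<^sup>2 * (exp (s * real m) * exp (- (real n / (real k)\<^sup>2 * (1 - exp (- s)))))) / \<epsilon>))"
proof -
  define V where "V = {1..n}"
  have V: "finite V" "V \<noteq> {}" "card V = n" "2 \<le> card V"
    using n by (auto simp: V_def)
  define P where "P = unif_points V"
  define N where "N = real n powr (- \<alpha> / 2)"
  define a where "a = N * \<epsilon>"
  define b where "b = N * ((real n - (real m - 1) * (real k)\<^sup>2) / \<epsilon>)"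
  define d where "d = N * ((real m - 1) / \<epsilon>)"
  define z where "z = exp (s * real m) * exp (- (real n / (real k)\<^sup>2 * (1 - exp (- s))))"
  define r where "r = h0 powr \<alpha> * real k powr (- \<alpha>)"
  have nonneg: "0 \<le> a" "0 \<le> b" "0 \<le> d" "0 \<le> z" "0 \<le> r"
    using e k m by (auto simp: a_def b_def d_def z_def r_def N_def)
  have nbc: "0 \<le> nb_const \<alpha> c2"
    unfolding nb_const_def using nbcost_series_summable[OF pos(1,3)] by (intro suminf_nonneg) auto
  define f1 where "f1 = (\<lambda>x. \<Sum>q\<in>grid k. ennreal (cell_trees \<alpha> h k m V q x))"
  define f2 where "f2 = (\<lambda>x. \<Sum>i\<in>V. ennreal a * ennreal (nbcost \<alpha> c2 V i x))"
  define f3 where "f3 = (\<lambda>x. \<Sum>q\<in>grid k. ennreal d * ennreal (deficit k s m V q x))"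
  have ctm: "(\<lambda>x. ennreal (cell_trees \<alpha> h k m V q x)) \<in> borel_measurable P" if "q \<in> grid k" for q
    unfolding P_def
    by (rule nn_integral_cell_trees_le(2)[where h = h, OF V(1) that m h_measurable h_nonneg h_scale h_shift pos(1,4)])
  have nbm: "(\<lambda>x. ennreal (nbcost \<alpha> c2 V i x)) \<in> borel_measurable P" if "i \<in> V" for i
    unfolding P_def by (rule nn_integral_nbcost_le(2)[OF V(1) that V(4) pos(1,3)])
  have dfm: "(\<lambda>x. ennreal (deficit k s m V q x)) \<in> borel_measurable P" if "q \<in> grid k" for q
    unfolding P_def by (rule nn_integral_deficit(2)[OF V(1) that s])
  have fm: "f1 \<in> borel_measurable P" "f2 \<in> borel_measurable P" "f3 \<in> borel_measurable P"
    unfolding f1_def f2_def f3_def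
    by (intro borel_measurable_sum borel_measurable_times_ennreal borel_measurable_const ctm nbm dfm; assumption)+
  have ct0: "0 \<le> cell_trees \<alpha> h k m V q x" for q x
  proof -
    have "0 \<le> mst_on \<alpha> h I x" if "I \<subseteq> V" "card I = m" for I
      using that m finite_subset[OF that(1) V(1)]
      by (intro mst_weight_nonneg edge_weight_nonneg) auto
    then show ?thesis
      unfolding cell_trees_def by (intro sum_nonneg mult_nonneg_nonneg) auto
  qed
  have "mean_mst \<alpha> h n \<le> (\<integral>\<^sup>+x. f1 x + (f2 x + (ennreal b + f3 x)) \<partial>P)"
    unfolding mean_mst_def P_def V_def[symmetric]
  proof (rule nn_integral_mono)
    fix x assume x: "x \<in> space (unif_points V)"
    have "mst_on \<alpha> h V x \<le> (\<Sum>q\<in>grid k. cell_trees \<alpha> h k m V q x)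
      + real (card V) powr (- \<alpha> / 2) * (\<epsilon> * (\<Sum>i\<in>V. nbcost \<alpha> c2 V i x)
        + (real (card V) - (real m - 1) * (real k)\<^sup>2 + (real m - 1) * (\<Sum>q\<in>grid k. deficit k s m V q x)) / \<epsilon>)"
      by (rule mst_on_le_cell_trees[OF V(1,2) space_PiM_unifD[OF x] pos(1,3) e m s h_nonneg h_upper])
    also have "\<dots> = (\<Sum>q\<in>grid k. cell_trees \<alpha> h k m V q x) + ((\<Sum>i\<in>V. a * nbcost \<alpha> c2 V i x)
        + (b + (\<Sum>q\<in>grid k. d * deficit k s m V q x)))"
      unfolding V(3) N_def[symmetric] sum_distrib_left[symmetric] a_def b_def d_def
      by (simp add: algebra_simps add_divide_distrib diff_divide_distrib)
    finally have "ennreal (mst_on \<alpha> h V x) \<le> ennreal \<dots>"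
      by (rule ennreal_leI)
    also have "\<dots> = f1 x + (f2 x + (ennreal b + f3 x))"
      unfolding f1_def f2_def f3_def
      using nonneg ct0 nbcost_nonneg[of \<alpha> c2 V _ x] deficit_nonneg[of k s m V _ x]
      by (simp add: sum_nonneg ennreal_mult[symmetric])
    finally show "ennreal (MST \<alpha> h x n) \<le> f1 x + (f2 x + (ennreal b + f3 x))"
      by (simp add: MST_def V_def)
  qed
  also have "\<dots> = (\<integral>\<^sup>+x. f1 x \<partial>P) + ((\<integral>\<^sup>+x. f2 x \<partial>P) + (ennreal b + (\<integral>\<^sup>+x. f3 x \<partial>P)))"
    using fm by (simp add: nn_integral_add P_def emeasure_PiM_unif_space)
  also have "(\<integral>\<^sup>+x. f1 x \<partial>P) \<le> ennreal ((real k)\<^sup>2 * r) * mean_mst \<alpha> h m"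
  proof -
    have "(\<integral>\<^sup>+x. f1 x \<partial>P) = (\<Sum>q\<in>grid k. \<integral>\<^sup>+x. ennreal (cell_trees \<alpha> h k m V q x) \<partial>P)"
      unfolding f1_def by (rule nn_integral_sum[OF ctm])
    also have "\<dots> \<le> (\<Sum>q\<in>grid k. ennreal r * mean_mst \<alpha> h m)"
      unfolding P_def r_def mean_mst_def
      by (intro sum_mono nn_integral_cell_trees_le(1) V(1) m h_measurable h_nonneg h_scale h_shift pos; assumption)
    also have "\<dots> = ennreal ((real k)\<^sup>2 * r) * mean_mst \<alpha> h m"
      using nonneg by (simp add: grid_def power2_eq_square ennreal_mult ennreal_of_nat_eq_real_of_nat mult.assoc)
    finally show ?thesis .
  qed
  also have "(\<integral>\<^sup>+x. f2 x \<partial>P) \<le> ennreal (real n * (a * nb_const \<alpha> c2))"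
  proof -
    have "(\<integral>\<^sup>+x. f2 x \<partial>P) = (\<Sum>i\<in>V. \<integral>\<^sup>+x. ennreal a * ennreal (nbcost \<alpha> c2 V i x) \<partial>P)"
      unfolding f2_def
      by (rule nn_integral_sum) (intro borel_measurable_times_ennreal borel_measurable_const nbm)
    also have "\<dots> = (\<Sum>i\<in>V. ennreal a * (\<integral>\<^sup>+x. ennreal (nbcost \<alpha> c2 V i x) \<partial>P))"
      by (intro sum.cong refl nn_integral_cmult nbm)
    also have "\<dots> \<le> (\<Sum>i\<in>V. ennreal a * ennreal (nb_const \<alpha> c2))"
      unfolding P_def nb_const_def
      by (intro sum_mono mult_left_mono nn_integral_nbcost_le(1) V pos) auto
    also have "\<dots> = ennreal (real n * (a * nb_const \<alpha> c2))"
      using nonneg nbc by (simp add: V(3) ennreal_mult ennreal_of_nat_eq_real_of_nat)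
    finally show ?thesis .
  qed
  also have "(\<integral>\<^sup>+x. f3 x \<partial>P) \<le> ennreal ((real k)\<^sup>2 * (d * z))"
  proof -
    have "(\<integral>\<^sup>+x. f3 x \<partial>P) = (\<Sum>q\<in>grid k. \<integral>\<^sup>+x. ennreal d * ennreal (deficit k s m V q x) \<partial>P)"
      unfolding f3_def
      by (rule nn_integral_sum) (intro borel_measurable_times_ennreal borel_measurable_const dfm)
    also have "\<dots> = (\<Sum>q\<in>grid k. ennreal d * (\<integral>\<^sup>+x. ennreal (deficit k s m V q x) \<partial>P))"
      by (intro sum.cong refl nn_integral_cmult dfm)
    also have "\<dots> \<le> (\<Sum>q\<in>grid k. ennreal d * ennreal z)"
      unfolding P_def z_def V(3)[symmetric]
      by (intro sum_mono mult_left_mono nn_integral_deficit(1) V s) auto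
    also have "\<dots> = ennreal ((real k)\<^sup>2 * (d * z))"
      using nonneg by (simp add: grid_def power2_eq_square ennreal_mult ennreal_of_nat_eq_real_of_nat mult.assoc)
    finally show ?thesis .
  qed
  also have "ennreal (real n * (a * nb_const \<alpha> c2)) + (ennreal b + ennreal ((real k)\<^sup>2 * (d * z)))
    = ennreal (N * (\<epsilon> * (real n * nb_const \<alpha> c2)
      + (real n - (real m - 1) * (real k)\<^sup>2 + (real m - 1) * (real k)\<^sup>2 * z) / \<epsilon>))"
  proof -
    have "ennreal (real n * (a * nb_const \<alpha> c2)) + (ennreal b + ennreal ((real k)\<^sup>2 * (d * z)))
        = ennreal (real n * (a * nb_const \<alpha> c2) + (b + (real k)\<^sup>2 * (d * z)))"
      using nonneg nbc by simp
    also have "real n * (a * nb_const \<alpha> c2) + (b + (real k)\<^sup>2 * (d * z))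
        = N * (\<epsilon> * (real n * nb_const \<alpha> c2)
          + (real n - (real m - 1) * (real k)\<^sup>2 + (real m - 1) * (real k)\<^sup>2 * z) / \<epsilon>)"
      by (simp add: a_def b_def d_def algebra_simps add_divide_distrib diff_divide_distrib)
    finally show ?thesis .
  qed
  finally show ?thesis
    unfolding N_def z_def r_def by (simp add: add_left_mono add_right_mono)
qed

text \<open>
  A tree edge either has length at least \<open>t\<close>, and then weight at least \<open>(c1 * t) powr \<alpha>\<close>, or is a
  pair of points at distance at most \<open>t\<close>, of which there are few.
\<close>

lemma mean_mst_lower:
  assumes n: "2 \<le> n"
  shows "ennreal ((c1 / 4) powr \<alpha> / 4 * real n powr (1 - \<alpha> / 2)) \<le> mean_mst \<alpha> h n"
proof -
  define V where "V = {1..n}"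
  have V: "finite V" "V \<noteq> {}" "card V = n" "2 \<le> card V"
    using n by (auto simp: V_def)
  \<comment> \<open>A pair is close with probability at most \<open>4 * t^2\<close>, so at most \<open>n / 4\<close> close pairs are expected.\<close>
  define t where "t = 1 / (4 * sqrt (real n))"
  have t: "0 < t" "4 * t\<^sup>2 = 1 / (4 * real n)"
    using n by (auto simp: t_def power_divide power_mult_distrib)
  define w where "w = (c1 * t) powr \<alpha>"
  have w: "0 < w"
    using pos t by (simp add: w_def)
  define C where "C = complete_edges V"
  define close :: "nat set \<Rightarrow> (nat \<Rightarrow> real ^ 2) \<Rightarrow> real" where "close = (\<lambda>e x. indicator {x. dist (x (Min e)) (x (Max e)) \<le> t} x :: real)"
  have closem: "(\<lambda>x. ennreal (close e x)) \<in> borel_measurable (unif_points V)"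
    and closei: "(\<integral>\<^sup>+x. ennreal (close e x) \<partial>unif_points V) \<le> ennreal (4 * t\<^sup>2)" if e: "e \<in> C" for e
  proof -
    obtain i j where ij: "i \<in> V" "j \<in> V" "i < j" "e = {i, j}"
      using e unfolding C_def by (rule complete_edgesE)
    have eq: "ennreal (close e x) = indicator {x. dist (x i) (x j) \<le> t} x" for x
      using ij(3) by (simp add: close_def ij(4) ennreal_indicator min_def max_def)
    show "(\<lambda>x. ennreal (close e x)) \<in> borel_measurable (unif_points V)"
      "(\<integral>\<^sup>+x. ennreal (close e x) \<partial>unif_points V) \<le> ennreal (4 * t\<^sup>2)"
      unfolding eq using nn_integral_close_pair_le[OF V(1) ij(1,2), of t] ij(3) t by auto
  qed
  have finC: "finite C"
    unfolding C_def by (rule finite_complete_edges[OF V(1)])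
  have cardC: "real (card C) \<le> (real n)\<^sup>2"
  proof -
    have "card C = n choose 2"
      using n_subsets[OF V(1), of 2] V(3) by (simp add: C_def complete_edges_def)
    then have "card C \<le> n ^ 2"
      using binomial_le_pow[OF n] by simp
    then show ?thesis
      by (metis of_nat_le_iff of_nat_power)
  qed
  have pw: "w * real n / 2 \<le> mst_on \<alpha> h V x + w * (\<Sum>e\<in>C. close e x)"
    if x: "x \<in> space (unif_points V)" for x
  proof -
    obtain T where T: "T \<in> spanning_trees V" "mst_on \<alpha> h V x = (\<Sum>e\<in>T. edge_weight \<alpha> h x e)"
      using mst_weight_attained[OF V(1,2)] .
    have TC: "T \<subseteq> C"
      using T(1) by (simp add: spanning_trees_def C_def)
    have edge: "w \<le> edge_weight \<alpha> h x e + w * close e x" if e: "e \<in> T" for e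
    proof -
      have "e \<in> complete_edges V"
        using e TC by (auto simp: C_def)
      then obtain i j where ij: "i \<in> V" "j \<in> V" "i < j" "e = {i, j}"
        by (rule complete_edgesE)
      show ?thesis
      proof (cases "dist (x i) (x j) \<le> t")
        case True
        then show ?thesis
          using ij(3) by (simp add: close_def ij(4) min_def max_def edge_weight_nonneg)
      next
        case False
        have "c1 * t \<le> c1 * dist (x i) (x j)"
          using False pos by simp
        also have "\<dots> \<le> h (x i) (x j)"
          using ij x by (intro h_lower unit_box_subset_square space_PiM_unifD[OF x]) auto
        finally have "w \<le> h (x i) (x j) powr \<alpha>"
          unfolding w_def using pos t by (intro powr_mono2) auto
        moreover have "0 \<le> w * close e x"
          using w by (simp add: close_def)
        ultimately show ?thesis
          using ij(3) by (simp add: ij(4) edge_weight_doubleton)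
      qed
    qed
    have "w * real n / 2 \<le> w * real (card T)"
      using card_spanning_tree_ge[OF T(1) V(1,4)] w V(3) by (simp add: field_simps)
    also have "\<dots> = (\<Sum>e\<in>T. w)"
      by simp
    also have "\<dots> \<le> (\<Sum>e\<in>T. edge_weight \<alpha> h x e + w * close e x)"
      by (intro sum_mono edge)
    also have "\<dots> = mst_on \<alpha> h V x + w * (\<Sum>e\<in>T. close e x)"
      by (simp add: T(2) sum.distrib sum_distrib_left)
    also have "(\<Sum>e\<in>T. close e x) \<le> (\<Sum>e\<in>C. close e x)"
      using finC TC by (intro sum_mono2) (auto simp: close_def)
    finally show ?thesis
      using w by simp
  qed
  have mst0: "0 \<le> mst_on \<alpha> h V x" for x
    by (intro mst_weight_nonneg V edge_weight_nonneg)
  have mm: "(\<lambda>x. ennreal (mst_on \<alpha> h V x)) \<in> borel_measurable (unif_points V)"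
    by (intro measurable_compose[OF measurable_mst_on measurable_ennreal]
        h_measurable V(1) measurable_PiM_unif_component)
  have "ennreal (w * real n / 2) = (\<integral>\<^sup>+x. ennreal (w * real n / 2) \<partial>unif_points V)"
    by (simp add: emeasure_PiM_unif_space)
  also have "\<dots> \<le> (\<integral>\<^sup>+x. ennreal (mst_on \<alpha> h V x) + ennreal w * (\<Sum>e\<in>C. ennreal (close e x)) \<partial>unif_points V)"
  proof (rule nn_integral_mono)
    fix x assume "x \<in> space (unif_points V)"
    then have "ennreal (w * real n / 2) \<le> ennreal (mst_on \<alpha> h V x + w * (\<Sum>e\<in>C. close e x))"
      by (intro ennreal_leI pw)
    also have "\<dots> = ennreal (mst_on \<alpha> h V x) + ennreal w * (\<Sum>e\<in>C. ennreal (close e x))"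
      using w mst0[of x] by (simp add: close_def sum_nonneg ennreal_mult)
    finally show "ennreal (w * real n / 2) \<le> \<dots>" .
  qed
  also have "\<dots> = mean_mst \<alpha> h n + ennreal w * (\<Sum>e\<in>C. \<integral>\<^sup>+x. ennreal (close e x) \<partial>unif_points V)"
  proof -
    have "(\<lambda>x. \<Sum>e\<in>C. ennreal (close e x)) \<in> borel_measurable (unif_points V)"
      by (intro borel_measurable_sum closem)
    then have "(\<integral>\<^sup>+x. ennreal (mst_on \<alpha> h V x) + ennreal w * (\<Sum>e\<in>C. ennreal (close e x)) \<partial>unif_points V)
        = (\<integral>\<^sup>+x. ennreal (mst_on \<alpha> h V x) \<partial>unif_points V)
          + ennreal w * (\<integral>\<^sup>+x. (\<Sum>e\<in>C. ennreal (close e x)) \<partial>unif_points V)"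
      using mm by (simp add: nn_integral_add nn_integral_cmult)
    also have "(\<integral>\<^sup>+x. (\<Sum>e\<in>C. ennreal (close e x)) \<partial>unif_points V)
        = (\<Sum>e\<in>C. \<integral>\<^sup>+x. ennreal (close e x) \<partial>unif_points V)"
      by (rule nn_integral_sum[OF closem])
    also have "(\<integral>\<^sup>+x. ennreal (mst_on \<alpha> h V x) \<partial>unif_points V) = mean_mst \<alpha> h n"
      by (simp only: mean_mst_def MST_def V_def)
    finally show ?thesis .
  qed
  also have "\<dots> \<le> mean_mst \<alpha> h n + ennreal w * (\<Sum>e\<in>C. ennreal (4 * t\<^sup>2))"
    by (intro add_left_mono mult_left_mono sum_mono closei) auto
  also have "\<dots> = mean_mst \<alpha> h n + ennreal (w * (real (card C) * (4 * t\<^sup>2)))"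
    using w by (simp add: ennreal_mult ennreal_of_nat_eq_real_of_nat)
  also have "\<dots> \<le> mean_mst \<alpha> h n + ennreal (w * (real n / 4))"
  proof -
    have "real (card C) * (4 * t\<^sup>2) \<le> (real n)\<^sup>2 * (4 * t\<^sup>2)"
      using cardC by (intro mult_right_mono) auto
    also have "\<dots> = real n / 4"
      unfolding t(2) using n by (simp add: power2_eq_square)
    finally show ?thesis
      using w by (intro add_left_mono ennreal_leI mult_left_mono) auto
  qed
  finally have main: "ennreal (w * real n / 2) \<le> mean_mst \<alpha> h n + ennreal (w * (real n / 4))" .
  have "ennreal (w * (real n / 4)) \<le> mean_mst \<alpha> h n"
  proof (cases "mean_mst \<alpha> h n")
    case (real r)
    then have "w * real n / 2 \<le> r + w * (real n / 4)"
      using main w by (simp add: ennreal_plus[symmetric] del: ennreal_plus)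
    then show ?thesis
      using real by (simp add: ennreal_leI)
  qed simp
  moreover have "w * (real n / 4) = (c1 / 4) powr \<alpha> / 4 * real n powr (1 - \<alpha> / 2)"
  proof -
    have "c1 * t = (c1 / 4) / real n powr (1 / 2)"
      using n by (simp add: t_def powr_half_sqrt)
    then have "w = (c1 / 4) powr \<alpha> / real n powr (\<alpha> / 2)"
      using pos n by (simp add: w_def powr_divide powr_mult powr_powr)
    moreover have "real n = real n powr 1"
      using n by simp
    ultimately show ?thesis
      by (simp add: powr_diff)
  qed
  ultimately show ?thesis
    by simp
qed

end

section \<open>Comparison of the upper and the lower limit\<close>

context homogeneous_weight
begin

definition normalized :: "nat \<Rightarrow> real" where
  "normalized n = enn2real (mean_mst \<alpha> h n) / real n powr (1 - \<alpha> / 2)"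

text \<open>
  Without cells, all points except the root are attached to a lower neighbour.
\<close>

lemma mean_mst_crude:
  assumes n: "2 \<le> n"
  shows "mean_mst \<alpha> h n \<le> ennreal ((nb_const \<alpha> c2 + 1) * real n powr (1 - \<alpha> / 2))"
proof -
  have "mean_mst \<alpha> h n \<le> ennreal (real n powr (- \<alpha> / 2) * (1 * (real n * nb_const \<alpha> c2) + (real n) / 1))"
    using mean_mst_step[OF n, of 1 1 0 0] by simp
  also have "real n powr (- \<alpha> / 2) * (1 * (real n * nb_const \<alpha> c2) + (real n) / 1)
      = (nb_const \<alpha> c2 + 1) * real n powr (1 - \<alpha> / 2)"
  proof -
    have "real n powr (1 - \<alpha> / 2) = real n * real n powr (- \<alpha> / 2)"
      using n powr_add[of "real n" 1 "- \<alpha> / 2"] by simp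
    then show ?thesis
      by (simp add: algebra_simps)
  qed
  finally show ?thesis .
qed

lemma mean_mst_finite: "2 \<le> n \<Longrightarrow> ennreal (enn2real (mean_mst \<alpha> h n)) = mean_mst \<alpha> h n"
  using mean_mst_crude[of n] by (intro ennreal_enn2real) (auto simp: less_top[symmetric] top_unique)

lemma normalized_bounds:
  assumes n: "2 \<le> n"
  shows "(c1 / 4) powr \<alpha> / 4 \<le> normalized n" "normalized n \<le> nb_const \<alpha> c2 + 1"
proof -
  define N where "N = real n powr (1 - \<alpha> / 2)"
  have N: "0 < N"
    using n by (simp add: N_def)
  have nbc: "0 \<le> nb_const \<alpha> c2"
    unfolding nb_const_def using nbcost_series_summable[OF pos(1,3)] by (intro suminf_nonneg) auto
  have "ennreal ((c1 / 4) powr \<alpha> / 4 * N) \<le> ennreal (enn2real (mean_mst \<alpha> h n))"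
    using mean_mst_lower[OF n] by (simp add: mean_mst_finite[OF n] N_def)
  then have "(c1 / 4) powr \<alpha> / 4 * N \<le> enn2real (mean_mst \<alpha> h n)"
    by (subst (asm) ennreal_le_iff) auto
  then show "(c1 / 4) powr \<alpha> / 4 \<le> normalized n"
    using N by (simp add: normalized_def N_def[symmetric] pos_le_divide_eq)
  have "ennreal (enn2real (mean_mst \<alpha> h n)) \<le> ennreal ((nb_const \<alpha> c2 + 1) * N)"
    using mean_mst_crude[OF n] by (simp add: mean_mst_finite[OF n] N_def)
  then have "enn2real (mean_mst \<alpha> h n) \<le> (nb_const \<alpha> c2 + 1) * N"
    using N nbc by (subst (asm) ennreal_le_iff) auto
  then show "normalized n \<le> nb_const \<alpha> c2 + 1"
    using N by (simp add: normalized_def N_def[symmetric] pos_divide_le_eq)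
qed

lemma normalized_step:
  assumes n: "2 \<le> n" and m: "2 \<le> m" and e: "0 < \<epsilon>" and s: "0 \<le> s" and k: "0 < k"
    and u: "u = (real k)\<^sup>2 / real n" and mu: "real m * u \<le> 1"
  shows "normalized n \<le> h0 powr \<alpha> * (real m * u) powr (1 - \<alpha> / 2) * normalized m
    + (\<epsilon> * nb_const \<alpha> c2
      + (1 - (real m - 1) * u + (real m - 1) * u * exp (s * real m - (1 / u) * (1 - exp (- s)))) / \<epsilon>)"
proof -
  define \<beta> where "\<beta> = 1 - \<alpha> / 2"
  define D where "D = (\<lambda>n. enn2real (mean_mst \<alpha> h n))"
  define z where "z = exp (s * real m - (1 / u) * (1 - exp (- s)))"
  have k2: "(real k)\<^sup>2 = u * real n"
    using n u by simp
  have u0: "0 < u"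
    using n k u by simp
  have "(real m - 1) * (real k)\<^sup>2 \<le> (real m * u) * real n"
    using u0 n by (simp add: k2 algebra_simps)
  also have "\<dots> \<le> real n"
    using mu by (simp add: mult_left_le_one_le mult_right_le_one_le u0 less_imp_le)
  finally have km: "(real m - 1) * (real k)\<^sup>2 \<le> real n" .
  have nbc: "0 \<le> nb_const \<alpha> c2"
    unfolding nb_const_def using nbcost_series_summable[OF pos(1,3)] by (intro suminf_nonneg) auto
  define A where "A = (real k)\<^sup>2 * (h0 powr \<alpha> * real k powr (- \<alpha>))"
  define B where "B = real n powr (- \<alpha> / 2) * (\<epsilon> * (real n * nb_const \<alpha> c2)
      + (real n - (real m - 1) * (real k)\<^sup>2 + (real m - 1) * (real k)\<^sup>2 * z) / \<epsilon>)"
  have A0: "0 \<le> A"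
    by (simp add: A_def)
  have B0: "0 \<le> B"
    unfolding B_def using e km nbc m
    by (intro mult_nonneg_nonneg add_nonneg_nonneg divide_nonneg_nonneg) (auto simp: z_def)
  have zz: "exp (s * real m) * exp (- (real n / (real k)\<^sup>2 * (1 - exp (- s)))) = z"
    by (simp add: z_def exp_diff exp_minus field_simps u)
  have "ennreal (D n) \<le> ennreal A * ennreal (D m) + ennreal B"
    using mean_mst_step[OF n _ e s km, unfolded zz] m
    unfolding D_def mean_mst_finite[OF n] mean_mst_finite[OF m] A_def B_def by simp
  also have "\<dots> = ennreal (A * D m + B)"
    using A0 B0 by (simp add: ennreal_mult D_def)
  finally have D: "D n \<le> A * D m + B"
    using A0 B0 by (subst (asm) ennreal_le_iff) (auto simp: D_def)
  have nb: "real n powr \<beta> = real n * real n powr (- \<alpha> / 2)"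
    using n powr_add[of "real n" 1 "- \<alpha> / 2"] by (simp add: \<beta>_def)
  have "normalized n \<le> (A * D m + B) / real n powr \<beta>"
    using D n by (simp add: normalized_def D_def \<beta>_def divide_right_mono)
  also have "\<dots> = A * D m / real n powr \<beta> + B / real n powr \<beta>"
    by (rule add_divide_distrib)
  also have "A * D m / real n powr \<beta> = h0 powr \<alpha> * (real m * u) powr \<beta> * normalized m"
  proof -
    have sq: "real k powr 2 = (real k)\<^sup>2"
      using k by (simp add: powr_numeral)
    then have "(real k)\<^sup>2 powr \<beta> = real k powr (2 * \<beta>)"
      using powr_powr[of "real k" 2 \<beta>] by simp
    also have "\<dots> = real k powr (2 + - \<alpha>)"
      by (simp add: \<beta>_def)
    also have "\<dots> = real k powr 2 * real k powr (- \<alpha>)"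
      by (rule powr_add)
    finally have "(real k)\<^sup>2 powr \<beta> = (real k)\<^sup>2 * real k powr (- \<alpha>)"
      unfolding sq .
    then have "A = h0 powr \<alpha> * (u powr \<beta> * real n powr \<beta>)"
      using u0 by (simp add: A_def k2 powr_mult)
    then show ?thesis
      using n m u0 by (simp add: normalized_def D_def \<beta>_def[symmetric] powr_mult)
  qed
  also have "B / real n powr \<beta> = \<epsilon> * nb_const \<alpha> c2 + (1 - (real m - 1) * u + (real m - 1) * u * z) / \<epsilon>"
    unfolding B_def nb k2 using n e by (simp add: field_simps)
  finally show ?thesis
    by (simp add: \<beta>_def z_def)
qed

text \<open>
  For fixed \<open>m\<close>, the number \<open>k\<close> of cells per side is the largest one for which a cell
  expects at least \<open>(1 + \<delta>) * m\<close> points. Then \<open>u = k^2 / n\<close> converges to \<open>1 / ((1 + \<delta>) * m)\<close>, and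
  the bound of \<open>normalized_step\<close> is continuous in \<open>u\<close> there.
\<close>

lemma limsup_normalized_le:
  assumes m: "2 \<le> m" and d: "0 < \<delta>" and e: "0 < \<epsilon>" and s: "0 \<le> s"
  shows "limsup (\<lambda>n. ereal (normalized n))
    \<le> ereal (h0 powr \<alpha> * (1 / (1 + \<delta>)) powr (1 - \<alpha> / 2) * normalized m
    + (\<epsilon> * nb_const \<alpha> c2
      + (1 - (real m - 1) * (1 / ((1 + \<delta>) * real m))
        + (real m - 1) * (1 / ((1 + \<delta>) * real m)) * exp (s * real m - ((1 + \<delta>) * real m) * (1 - exp (- s)))) / \<epsilon>))"
proof -
  define \<kappa> where "\<kappa> = (1 + \<delta>) * real m"
  have \<kappa>: "0 < \<kappa>"
    using m d by (simp add: \<kappa>_def)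
  define k where "k = (\<lambda>n. nat \<lfloor>sqrt (real n / \<kappa>)\<rfloor>)"
  define u where "u = (\<lambda>n. (real (k n))\<^sup>2 / real n)"
  define R where "R = (\<lambda>v. h0 powr \<alpha> * (real m * v) powr (1 - \<alpha> / 2) * normalized m
    + (\<epsilon> * nb_const \<alpha> c2
      + (1 - (real m - 1) * v + (real m - 1) * v * exp (s * real m - (1 / v) * (1 - exp (- s)))) / \<epsilon>))"
  have u_le: "u n \<le> 1 / \<kappa>" for n
  proof -
    have "real (k n) \<le> sqrt (real n / \<kappa>)"
      using \<kappa> by (simp add: k_def)
    then have "(real (k n))\<^sup>2 \<le> real n / \<kappa>"
      using \<kappa> real_le_rsqrt by (metis (no_types) of_nat_0_le_iff real_sqrt_ge_0_iff real_sqrt_pow2 power_mono divide_nonneg_pos)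
    then show ?thesis
      using \<kappa> by (cases "n = 0") (auto simp: u_def field_simps)
  qed
  have "u \<longlonglongrightarrow> (inverse \<kappa> powr (1 / 2))\<^sup>2"
    unfolding u_def k_def using \<kappa> by real_asymp
  moreover have "(inverse \<kappa> powr (1 / 2))\<^sup>2 = 1 / \<kappa>"
    using \<kappa> by (simp add: powr_half_sqrt inverse_eq_divide)
  ultimately have u_lim: "u \<longlonglongrightarrow> 1 / \<kappa>"
    by simp
  have "filterlim k at_top sequentially"
    unfolding k_def using \<kappa> by real_asymp
  then have "eventually (\<lambda>n. 1 \<le> k n) sequentially"
    by (simp only: filterlim_at_top)
  moreover have "eventually (\<lambda>n. 2 \<le> n) sequentially"
    by (rule eventually_ge_at_top)
  ultimately have ev: "eventually (\<lambda>n. ereal (normalized n) \<le> ereal (R (u n))) sequentially"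
  proof eventually_elim
    case (elim n)
    have "real m * u n \<le> real m * (1 / \<kappa>)"
      using u_le by (intro mult_left_mono) auto
    also have "\<dots> \<le> 1"
      using m d by (simp add: \<kappa>_def divide_le_eq algebra_simps)
    finally show ?case
      unfolding R_def using normalized_step[OF elim(2) m e s _ _, of "k n" "u n"] elim(1) by (simp add: u_def)
  qed
  have "(\<lambda>n. R (u n)) \<longlonglongrightarrow> R (1 / \<kappa>)"
    unfolding R_def using u_lim \<kappa> m e by (intro tendsto_intros) auto
  then have lim: "(\<lambda>n. ereal (R (u n))) \<longlonglongrightarrow> ereal (R (1 / \<kappa>))"
    by simp
  have "limsup (\<lambda>n. ereal (normalized n)) \<le> limsup (\<lambda>n. ereal (R (u n)))"
    by (rule Limsup_mono[OF ev])
  also have "\<dots> = ereal (R (1 / \<kappa>))"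
    by (rule lim_imp_Limsup[OF sequentially_bot lim])
  also have "R (1 / \<kappa>) = h0 powr \<alpha> * (1 / (1 + \<delta>)) powr (1 - \<alpha> / 2) * normalized m
    + (\<epsilon> * nb_const \<alpha> c2
      + (1 - (real m - 1) * (1 / \<kappa>) + (real m - 1) * (1 / \<kappa>) * exp (s * real m - \<kappa> * (1 - exp (- s)))) / \<epsilon>)"
  proof -
    have "real m * (1 / \<kappa>) = 1 / (1 + \<delta>)"
      using m by (simp add: \<kappa>_def)
    then show ?thesis
      by (simp add: R_def)
  qed
  finally show ?thesis
    unfolding \<kappa>_def .
qed

text \<open>
  The previous bound holds for all \<open>m\<close>, with parameters that may depend on \<open>m\<close>. They are taken as
  \<open>\<delta> = m powr (-1/4)\<close>, \<open>s = \<delta> / 2\<close> and \<open>\<epsilon> = m powr (-1/16)\<close>. The exponent in the bound is then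
  about \<open>- (3/8) * m powr (1/2)\<close>, the fraction of attached points is of the order \<open>\<delta>\<close>, and
  both \<open>\<epsilon>\<close> and \<open>\<delta> / \<epsilon>\<close> tend to zero.
\<close>

lemma limsup_normalized_le_liminf:
  "limsup (\<lambda>n. ereal (normalized n)) \<le> ereal (h0 powr \<alpha>) * liminf (\<lambda>n. ereal (normalized n))"
proof -
  define H where "H = h0 powr \<alpha>"
  have H: "0 < H"
    using pos by (simp add: H_def)
  define L where "L = limsup (\<lambda>n. ereal (normalized n))"
  define b where "b = nb_const \<alpha> c2 + 1"
  \<comment> \<open>\<open>a\<close> is the factor of \<open>H * normalized m\<close> in the bound for \<open>m\<close>, and \<open>e\<close> its remaining part.\<close>
  define a where "a = (\<lambda>m::nat. (1 / (1 + real m powr (-1/4))) powr (1 - \<alpha> / 2))"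
  define e where "e = (\<lambda>m::nat. real m powr (-1/16) * nb_const \<alpha> c2
      + (1 - (real m - 1) * (1 / ((1 + real m powr (-1/4)) * real m))
        + (real m - 1) * (1 / ((1 + real m powr (-1/4)) * real m))
          * exp (real m powr (-1/4) / 2 * real m
              - ((1 + real m powr (-1/4)) * real m) * (1 - exp (- (real m powr (-1/4) / 2))))) / real m powr (-1/16))"
  have a_lim: "a \<longlonglongrightarrow> 1"
    unfolding a_def by real_asymp
  have e_lim: "e \<longlonglongrightarrow> 0"
    unfolding e_def by real_asymp
  define E where "E = (\<lambda>m. H * \<bar>a m - 1\<bar> * b + e m)"
  have "E \<longlonglongrightarrow> H * \<bar>1 - 1\<bar> * b + 0"
    unfolding E_def by (intro tendsto_intros a_lim e_lim)
  then have E_lim: "(\<lambda>m. ereal (E m)) \<longlonglongrightarrow> 0"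
    by (simp add: zero_ereal_def)
  have "eventually (\<lambda>m. L \<le> ereal (E m) + ereal (H * normalized m)) sequentially"
    using eventually_ge_at_top[of "2 :: nat"]
  proof eventually_elim
    case (elim m)
    have nm: "0 \<le> normalized m" "normalized m \<le> b"
      by (simp_all add: normalized_def) (use normalized_bounds(2)[OF elim] in \<open>simp add: b_def normalized_def\<close>)
    have "L \<le> ereal (H * a m * normalized m + e m)"
      unfolding L_def H_def a_def e_def by (rule limsup_normalized_le[OF elim]) (use elim in auto)
    also have "H * a m * normalized m + e m \<le> E m + H * normalized m"
    proof -
      have "(a m - 1) * normalized m \<le> \<bar>a m - 1\<bar> * b"
        using nm by (intro mult_mono) auto
      then have "H * ((a m - 1) * normalized m) \<le> H * (\<bar>a m - 1\<bar> * b)"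
        using H by (intro mult_left_mono) auto
      then show ?thesis
        by (simp add: E_def algebra_simps)
    qed
    finally show ?case
      by simp
  qed
  then have "L \<le> liminf (\<lambda>m. ereal (E m) + ereal (H * normalized m))"
    by (rule Liminf_bounded)
  also have "\<dots> = 0 + liminf (\<lambda>m. ereal (H * normalized m))"
    by (rule ereal_liminf_lim_add[OF E_lim]) simp
  also have "liminf (\<lambda>m. ereal (H * normalized m)) = ereal H * liminf (\<lambda>m. ereal (normalized m))"
    using Liminf_ereal_mult_left[of sequentially H "\<lambda>m. ereal (normalized m)"] H by simp
  finally show ?thesis
    by (simp add: L_def H_def)
qed

end

section \<open>The mean tree weight of the given points\<close>

text \<open>
  The weight depends on the first \<open>n\<close> points only, whose joint law is the product of uniform laws by
  independence.
\<close>

lemma (in prob_space) expectation_MST: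
  assumes iid: "indep_vars (\<lambda>_. borel) X {1..}"
    and uniform: "\<And>i. i \<ge> 1 \<Longrightarrow> distr M borel (X i) = uniform_measure lborel unit_square"
    and h: "(\<lambda>(u, v). h u v) \<in> borel_measurable (borel \<Otimes>\<^sub>M borel)"
    and n: "1 \<le> n"
  shows "expectation (\<lambda>\<omega>. MST \<alpha> h (\<lambda>i. X i \<omega>) n) = enn2real (mean_mst \<alpha> h n)"
proof -
  define V where "V = {1..n}"
  have V: "finite V" "V \<noteq> {}" "V \<subseteq> {1..}"
    using n by (auto simp: V_def)
  define B where "B = PiM V (\<lambda>_. borel :: (real ^ 2) measure)"
  have rv: "X i \<in> M \<rightarrow>\<^sub>M borel" if "i \<in> V" for i
    using iid V(3) that by (auto simp: indep_vars_def)
  have XB: "(\<lambda>\<omega>. \<lambda>i\<in>V. X i \<omega>) \<in> M \<rightarrow>\<^sub>M B"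
    unfolding B_def by (intro measurable_restrict rv)
  have mm: "(\<lambda>x. ennreal (mst_on \<alpha> h V x)) \<in> borel_measurable B"
    unfolding B_def
    by (intro measurable_compose[OF measurable_mst_on measurable_ennreal] h V(1) measurable_component_singleton)
  have distr_X: "distr M B (\<lambda>\<omega>. \<lambda>i\<in>V. X i \<omega>) = distr (unif_points V) B (compose V (\<lambda>x. x))"
  proof -
    have "indep_vars (\<lambda>_. borel) X V"
      by (rule indep_vars_subset[OF iid V(3)])
    then have "distr M B (\<lambda>\<omega>. \<lambda>i\<in>V. X i \<omega>) = PiM V (\<lambda>i. distr M borel (X i))"
      unfolding B_def using indep_vars_iff_distr_eq_PiM'[OF V(2), where M' = "\<lambda>_. borel" and X = X] rv by simp
    also have "\<dots> = PiM V (\<lambda>i. distr unif borel (\<lambda>x. x))"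
      using V(3) by (intro PiM_cong refl) (auto simp: uniform uniform_measure_unit_square)
    also have "\<dots> = distr (unif_points V) B (compose V (\<lambda>x. x))"
    proof -
      define borel' where "borel' = distr unif borel (\<lambda>x. x)"
      have "prob_space borel'"
        unfolding borel'_def by (rule prob_space.prob_space_distr[OF prob_space_unif measurable_unif_borel])
      moreover have "(\<lambda>x. x) \<in> unif \<rightarrow>\<^sub>M borel'"
        using measurable_unif_borel by (simp add: borel'_def)
      ultimately have "distr (unif_points V) (PiM V (\<lambda>_. borel')) (compose V (\<lambda>x. x))
          = PiM V (\<lambda>_. distr unif borel' (\<lambda>x. x))"
        by (intro distr_PiM_finite_prob_space' V(1) prob_space_unif)
      moreover have "distr unif borel' (\<lambda>x. x) = borel'"
        unfolding borel'_def by (intro distr_cong) auto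
      moreover have "distr (unif_points V) (PiM V (\<lambda>_. borel')) (compose V (\<lambda>x. x))
          = distr (unif_points V) B (compose V (\<lambda>x. x))"
        unfolding B_def by (intro distr_cong sets_PiM_cong) (auto simp: borel'_def)
      ultimately show ?thesis
        by (simp add: borel'_def)
    qed
    finally show ?thesis .
  qed
  have idB: "compose V (\<lambda>x. x) \<in> unif_points V \<rightarrow>\<^sub>M B"
    unfolding B_def compose_def by (intro measurable_restrict measurable_PiM_unif_component)
  have "(\<integral>\<^sup>+\<omega>. ennreal (mst_on \<alpha> h V (\<lambda>i. X i \<omega>)) \<partial>M)
      = (\<integral>\<^sup>+\<omega>. ennreal (mst_on \<alpha> h V (\<lambda>i\<in>V. X i \<omega>)) \<partial>M)"
    by (simp only: mst_on_restrict)
  also have "\<dots> = (\<integral>\<^sup>+x. ennreal (mst_on \<alpha> h V x) \<partial>distr M B (\<lambda>\<omega>. \<lambda>i\<in>V. X i \<omega>))"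
    by (rule nn_integral_distr[OF XB, symmetric]) (use mm in simp)
  also have "\<dots> = (\<integral>\<^sup>+x. ennreal (mst_on \<alpha> h V (compose V (\<lambda>x. x) x)) \<partial>unif_points V)"
    unfolding distr_X by (rule nn_integral_distr[OF idB]) (use mm in simp)
  also have "\<dots> = mean_mst \<alpha> h n"
    by (simp only: compose_def mst_on_restrict) (simp only: mean_mst_def MST_def V_def)
  finally have "(\<integral>\<^sup>+\<omega>. ennreal (mst_on \<alpha> h V (\<lambda>i. X i \<omega>)) \<partial>M) = mean_mst \<alpha> h n" .
  moreover have "(\<lambda>\<omega>. mst_on \<alpha> h V (\<lambda>i. X i \<omega>)) \<in> borel_measurable M"
    by (intro measurable_mst_on h V(1) rv)
  moreover have "0 \<le> mst_on \<alpha> h V (\<lambda>i. X i \<omega>)" for \<omega>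
    by (intro mst_weight_nonneg V edge_weight_nonneg)
  ultimately have "expectation (\<lambda>\<omega>. mst_on \<alpha> h V (\<lambda>i. X i \<omega>)) = enn2real (mean_mst \<alpha> h n)"
    by (subst integral_eq_nn_integral) auto
  then show ?thesis
    by (simp only: MST_def V_def)
qed

theorem theorem10:
  fixes M :: "'a measure"
    and X :: "nat \<Rightarrow> 'a \<Rightarrow> real ^ 2"
    and h :: "real ^ 2 \<Rightarrow> real ^ 2 \<Rightarrow> real"
    and \<alpha> c1 c2 h0 :: real
  assumes "prob_space M"
    and iid: "prob_space.indep_vars M (\<lambda>_. borel) X {1..}"
    and uniform: "\<And>i. i \<ge> 1 \<Longrightarrow> distr M borel (X i) = uniform_measure lborel unit_square"
    and "\<alpha> > 0" and "c1 > 0" and "c2 > 0" and "h0 > 0"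
    and h_measurable: "(\<lambda>(u, v). h u v) \<in> borel_measurable (borel \<Otimes>\<^sub>M borel)"
    and h_nonneg: "\<And>u v. h u v \<ge> 0"
    and h_sym: "\<And>x y. x \<in> unit_square \<Longrightarrow> y \<in> unit_square \<Longrightarrow> h x y = h y x"
    and h_bounds: "\<And>x y. x \<in> unit_square \<Longrightarrow> y \<in> unit_square \<Longrightarrow>
                     c1 * dist x y \<le> h x y \<and> h x y \<le> c2 * dist x y"
    and b1: "\<And>a u v. a > 0 \<Longrightarrow> h (a *\<^sub>R u) (a *\<^sub>R v) = a * h u v"
    and b2: "\<And>b u v. h (b + u) (b + v) \<le> h0 * h u v"
  shows "let r = (\<lambda>n::nat. ereal (prob_space.expectation M (\<lambda>\<omega>. MST \<alpha> h (\<lambda>i. X i \<omega>) n)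
                                / real n powr (1 - \<alpha> / 2)))
         in 0 < liminf r \<and> liminf r \<le> limsup r \<and>
            limsup r \<le> ereal (h0 powr \<alpha>) * liminf r \<and>
            ereal (h0 powr \<alpha>) * liminf r < \<infinity>"
proof -
  interpret prob_space M by fact
  interpret homogeneous_weight h \<alpha> c1 c2 h0
    by unfold_locales (use assms in auto)
  define r where "r = (\<lambda>n::nat. ereal (expectation (\<lambda>\<omega>. MST \<alpha> h (\<lambda>i. X i \<omega>) n) / real n powr (1 - \<alpha> / 2)))"
  define g where "g = (\<lambda>n. ereal (normalized n))"
  have "r n = g n" if "1 \<le> n" for n
    unfolding r_def g_def normalized_def
    using expectation_MST[OF iid uniform h_measurable that] by simp
  then have ev: "eventually (\<lambda>n. r n = g n) sequentially"
    using eventually_ge_at_top[of "1 :: nat"] by (rule eventually_mono[rotated])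
  have lims: "liminf r = liminf g" "limsup r = limsup g"
    using ev by (auto intro: Liminf_eq Limsup_eq)
  have "eventually (\<lambda>n. ereal ((c1 / 4) powr \<alpha> / 4) \<le> g n) sequentially"
    using eventually_ge_at_top[of "2 :: nat"]
    by (rule eventually_mono) (use normalized_bounds(1) in \<open>simp only: g_def ereal_less_eq\<close>)
  then have "ereal ((c1 / 4) powr \<alpha> / 4) \<le> liminf g"
    by (rule Liminf_bounded)
  moreover have "0 < ereal ((c1 / 4) powr \<alpha> / 4)"
    using pos by simp
  ultimately have lower: "0 < liminf g"
    by (rule less_le_trans[rotated])
  have le: "liminf g \<le> limsup g"
    by (rule Liminf_le_Limsup) simp
  have "eventually (\<lambda>n. g n \<le> ereal (nb_const \<alpha> c2 + 1)) sequentially"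
    using eventually_ge_at_top[of "2 :: nat"]
    by (rule eventually_mono) (use normalized_bounds(2) in \<open>simp only: g_def ereal_less_eq\<close>)
  then have "limsup g \<le> ereal (nb_const \<alpha> c2 + 1)"
    by (rule Limsup_bounded)
  with le have "liminf g \<le> ereal (nb_const \<alpha> c2 + 1)"
    by (rule order_trans)
  then have "ereal (h0 powr \<alpha>) * liminf g < \<infinity>"
    using lower by (cases "liminf g") simp_all
  moreover have "limsup g \<le> ereal (h0 powr \<alpha>) * liminf g"
    unfolding g_def by (rule limsup_normalized_le_liminf)
  ultimately show ?thesis
    unfolding Let_def r_def[symmetric] lims using lower le by blast
qed

end
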